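(* Let $\mathcal{C}$ be a regular protomodular category with a fixed class $\mathcal{Z}$ of zero objects. Let $(\mathcal{T},\mathcal{F})$ be a $\mathcal{Z}$-torsion theory in $\mathcal{C}$ satisfying Conditions (M') and (S), with reflector $\mathsf{F}\colon\mathcal{C}\to\mathcal{F}$ left adjoint to the inclusion $\mathsf{i}\colon\mathcal{F}\hookrightarrow\mathcal{C}$. Then $\Gamma=(\mathsf{F},\mathsf{i},\mathrm{Arr}(\mathcal{C}),\mathrm{Arr}(\mathcal{F}))$, where $\mathrm{Arr}(-)$ denotes the class of all arrows, is an admissible Galois structure.
   Context: A category is protomodular if it has pullbacks of split epimorphisms along any arrow and, whenever a split epimorphism $p\colon C\to B$ with section $s$ is pulled back along $f\colon A\to B$, giving $g\colon A\times_B C\to C$, the pair $(g,s)$ is jointly extremally epimorphic. A class of zero objects in a category $\mathcal{C}$ is a full subcategory $\mathcal{Z}$ (taken closed under isomorphism) which is posetal (at most one morphism between any two of its objects), monocoreflective (the inclusion has a right adjoint $\mathsf{Z}$, the coreflector, with every counit component $\varepsilon_A\colon\mathsf{Z}(A)\to A$ a monomorphism), and such that $\mathsf{Z}(m)$ is an isomorphism for every monomorphism $m$ of $\mathcal{C}$. $\mathcal{N}_{\mathcal{Z}}$ denotes the class of arrows of $\mathcal{C}$ factoring through an object of $\mathcal{Z}$. A $\mathcal{Z}$-kernel of $f\colon A\to B$ is an arrow $k\colon K\to A$ with $fk\in\mathcal{N}_{\mathcal{Z}}$ such that every $e\colon E\to A$ with $fe\in\mathcal{N}_{\mathcal{Z}}$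 factors uniquely through $k$; $\mathcal{Z}$-cokernels are defined dually. A sequence $A\xrightarrow{f}B\xrightarrow{g}C$ is short $\mathcal{Z}$-exact if $f$ is a $\mathcal{Z}$-kernel of $g$ and $g$ is a $\mathcal{Z}$-cokernel of $f$. A $\mathcal{Z}$-torsion theory is a pair $(\mathcal{T},\mathcal{F})$ of full replete subcategories of $\mathcal{C}$ such that: $\mathcal{T}\cap\mathcal{F}=\mathcal{Z}$; every arrow $T\to F$ with $T\in\mathcal{T}$, $F\in\mathcal{F}$ lies in $\mathcal{N}_{\mathcal{Z}}$; for every $A\in\mathcal{C}$ there is a short $\mathcal{Z}$-exact sequence $\mathsf{T}(A)\xrightarrow{t_A}A\xrightarrow{\eta_A}\mathsf{F}(A)$ with $\mathsf{T}(A)\in\mathcal{T}$, $\mathsf{F}(A)\in\mathcal{F}$ (unique up to isomorphism). The assignment $\mathsf{F}$ extends to a functor $\mathcal{C}\to\mathcal{F}$ left adjoint to the inclusion, with unit $\eta$. If $T\in\mathcal{T}$ then $\mathsf{F}(T)\in\mathcal{Z}$. Condition (M'): for every object $A$ of $\mathcal{C}$, $\mathsf{F}(\mathsf{T}(A))\cong\mathsf{Z}(\mathsf{F}(A))$. Condition (S): for every $T\in\mathcal{T}$, with $\eta_T\colon T\to Z$, $Z=\mathsf{F}(T)\in\mathcal{Z}$, and every arrow $Z'\to Z$ with $Z'\in\mathcal{Z}$, the pullback $\chi\colon T'\to Z'$ of $\eta_T$ along $Z'\to Z$ satisfies $T'\in\mathcal{T}$ and $\chi=\eta_{T'}$ (up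 to isomorphism). Given a category $\mathcal{A}$ with pullbacks, a class of arrows is admissible if it contains all isomorphisms, is closed under composition, and whenever two arrows with common codomain are in it, both projections of their pullback are in it. A relatively admissible adjunction $(\mathsf{S},\mathsf{C},\mathbb{A},\mathbb{P})$ is an adjunction $\mathsf{S}\dashv\mathsf{C}\colon\mathcal{P}\to\mathcal{A}$ between categories with pullbacks, with admissible classes $\mathbb{A}$ of arrows of $\mathcal{A}$ and $\mathbb{P}$ of arrows of $\mathcal{P}$ such that $\mathsf{S}(\mathbb{A})\subseteq\mathbb{P}$, $\mathsf{C}(\mathbb{P})\subseteq\mathbb{A}$, all unit components are in $\mathbb{A}$ and all counit components are in $\mathbb{P}$. For $A\in\mathcal{A}$, $\mathbb{A}/A$ is the full subcategory of the slice $\mathcal{A}/A$ on arrows in $\mathbb{A}$ (similarly $\mathbb{P}/\mathsf{S}(A)$); the functor $\mathsf{C}_A\colon\mathbb{P}/\mathsf{S}(A)\to\mathbb{A}/A$ sends $g\colon P\to\mathsf{S}(A)$ to the pullback of $\mathsf{C}(g)$ along the unit component $A\to\mathsf{CS}(A)$. The adjunction is admissible (an admissible Galois structure) if $\mathsf{C}_A$ is full and faithful for every $A\in\mathcal{A}$. *)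

theory Defs
  imports Main
begin

section \<open>Categories\<close>

record ('o, 'a) cat =
  Obj :: "'o set"
  Arr :: "'a set"
  Dom :: "'a \<Rightarrow> 'o"
  Cod :: "'a \<Rightarrow> 'o"
  Ident :: "'o \<Rightarrow> 'a"
  Comp :: "'a \<Rightarrow> 'a \<Rightarrow> 'a"  (infixr "\<cdot>\<index>" 70)

text \<open>Composition is written in the usual order: \<open>g \<cdot>\<^bsub>C\<^esub> f\<close> is "first \<open>f\<close>, then \<open>g\<close>".\<close>

definition hom :: "('o, 'a, 'm) cat_scheme \<Rightarrow> 'o \<Rightarrow> 'o \<Rightarrow> 'a set" where
  "hom C A B = {f \<in> Arr C. Dom C f = A \<and> Cod C f = B}"

locale category =
  fixes C :: "('o, 'a, 'm) cat_scheme" (structure)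
  assumes Dom_Obj: "f \<in> Arr C \<Longrightarrow> Dom C f \<in> Obj C"
    and Cod_Obj: "f \<in> Arr C \<Longrightarrow> Cod C f \<in> Obj C"
    and Ident_hom: "A \<in> Obj C \<Longrightarrow> Ident C A \<in> hom C A A"
    and Comp_hom: "f \<in> hom C X Y \<Longrightarrow> g \<in> hom C Y W \<Longrightarrow> g \<cdot> f \<in> hom C X W"
    and Comp_Ident: "f \<in> hom C X Y \<Longrightarrow> f \<cdot> Ident C X = f"
    and Ident_Comp: "f \<in> hom C X Y \<Longrightarrow> Ident C Y \<cdot> f = f"
    and Comp_assoc: "f \<in> hom C W X \<Longrightarrow> g \<in> hom C X Y \<Longrightarrow> h \<in> hom C Y V \<Longrightarrow>
      (h \<cdot> g) \<cdot> f = h \<cdot> (g \<cdot> f)"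

definition monic :: "('o, 'a, 'm) cat_scheme \<Rightarrow> 'a \<Rightarrow> bool" where
  "monic C m \<longleftrightarrow> m \<in> Arr C \<and>
    (\<forall>X. \<forall>u \<in> hom C X (Dom C m). \<forall>v \<in> hom C X (Dom C m). m \<cdot>\<^bsub>C\<^esub> u = m \<cdot>\<^bsub>C\<^esub> v \<longrightarrow> u = v)"

definition is_iso :: "('o, 'a, 'm) cat_scheme \<Rightarrow> 'a \<Rightarrow> bool" where
  "is_iso C f \<longleftrightarrow> f \<in> Arr C \<and>
    (\<exists>g \<in> hom C (Cod C f) (Dom C f).
      g \<cdot>\<^bsub>C\<^esub> f = Ident C (Dom C f) \<and> f \<cdot>\<^bsub>C\<^esub> g = Ident C (Cod C f))"

definition isomorphic :: "('o, 'a, 'm) cat_scheme \<Rightarrow> 'o \<Rightarrow> 'o \<Rightarrow> bool" where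
  "isomorphic C A B \<longleftrightarrow> (\<exists>f \<in> hom C A B. is_iso C f)"

text \<open>A full subcategory is given by its set of objects.\<close>

definition full_sub :: "('o, 'a) cat \<Rightarrow> 'o set \<Rightarrow> ('o, 'a) cat" where
  "full_sub C S = \<lparr>Obj = S, Arr = {f \<in> Arr C. Dom C f \<in> S \<and> Cod C f \<in> S},
     Dom = Dom C, Cod = Cod C, Ident = Ident C, Comp = Comp C\<rparr>"

definition replete :: "('o, 'a) cat \<Rightarrow> 'o set \<Rightarrow> bool" where
  "replete C S \<longleftrightarrow> S \<subseteq> Obj C \<and> (\<forall>A \<in> S. \<forall>B \<in> Obj C. isomorphic C A B \<longrightarrow> B \<in> S)"

text \<open>Objects of the slice over \<open>A\<close> are the arrows with codomain \<open>A\<close>. The triple \<open>(f, g, h)\<close> is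
  the arrow \<open>h\<close> regarded as a morphism from \<open>f\<close> to \<open>g\<close>, that is, with \<open>g \<cdot> h = f\<close>.\<close>

definition slice :: "('o, 'a) cat \<Rightarrow> 'o \<Rightarrow> ('a, 'a \<times> 'a \<times> 'a) cat" where
  "slice C A = \<lparr>Obj = {f \<in> Arr C. Cod C f = A},
     Arr = {(f, g, h). f \<in> Arr C \<and> Cod C f = A \<and> g \<in> Arr C \<and> Cod C g = A \<and>
             h \<in> hom C (Dom C f) (Dom C g) \<and> g \<cdot>\<^bsub>C\<^esub> h = f},
     Dom = (\<lambda>(f, g, h). f), Cod = (\<lambda>(f, g, h). g),
     Ident = (\<lambda>f. (f, f, Ident C (Dom C f))),
     Comp = (\<lambda>(f', g', h') (f, g, h). (f, g', h' \<cdot>\<^bsub>C\<^esub> h))\<rparr>"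

definition slice_on :: "('o, 'a) cat \<Rightarrow> 'a set \<Rightarrow> 'o \<Rightarrow> ('a, 'a \<times> 'a \<times> 'a) cat" where
  "slice_on C \<A> A = full_sub (slice C A) {f \<in> \<A>. f \<in> Arr C \<and> Cod C f = A}"


section \<open>Pullbacks, regular and protomodular categories\<close>

text \<open>\<open>is_pullback C f g p q\<close>: the square \<open>f \<cdot> p = g \<cdot> q\<close> is a pullback; \<open>p\<close> is the pullback of
  \<open>g\<close> along \<open>f\<close> and \<open>q\<close> is the pullback of \<open>f\<close> along \<open>g\<close>.\<close>

definition is_pullback :: "('o, 'a) cat \<Rightarrow> 'a \<Rightarrow> 'a \<Rightarrow> 'a \<Rightarrow> 'a \<Rightarrow> bool" where
  "is_pullback C f g p q \<longleftrightarrow>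
    f \<in> Arr C \<and> g \<in> Arr C \<and> p \<in> Arr C \<and> q \<in> Arr C \<and>
    Cod C f = Cod C g \<and> Dom C p = Dom C q \<and> Cod C p = Dom C f \<and> Cod C q = Dom C g \<and>
    f \<cdot>\<^bsub>C\<^esub> p = g \<cdot>\<^bsub>C\<^esub> q \<and>
    (\<forall>X. \<forall>u \<in> hom C X (Dom C f). \<forall>v \<in> hom C X (Dom C g). f \<cdot>\<^bsub>C\<^esub> u = g \<cdot>\<^bsub>C\<^esub> v \<longrightarrow>
      (\<exists>!w. w \<in> hom C X (Dom C p) \<and> p \<cdot>\<^bsub>C\<^esub> w = u \<and> q \<cdot>\<^bsub>C\<^esub> w = v))"

definition has_pullbacks :: "('o, 'a) cat \<Rightarrow> bool" where
  "has_pullbacks C \<longleftrightarrow>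
    (\<forall>f \<in> Arr C. \<forall>g \<in> Arr C. Cod C f = Cod C g \<longrightarrow> (\<exists>p q. is_pullback C f g p q))"

definition has_terminal :: "('o, 'a) cat \<Rightarrow> bool" where
  "has_terminal C \<longleftrightarrow> (\<exists>I \<in> Obj C. \<forall>A \<in> Obj C. \<exists>!f. f \<in> hom C A I)"

definition finitely_complete :: "('o, 'a) cat \<Rightarrow> bool" where
  "finitely_complete C \<longleftrightarrow> category C \<and> has_terminal C \<and> has_pullbacks C"

definition is_coequalizer :: "('o, 'a) cat \<Rightarrow> 'a \<Rightarrow> 'a \<Rightarrow> 'a \<Rightarrow> bool" where
  "is_coequalizer C f g q \<longleftrightarrow>
    f \<in> Arr C \<and> g \<in> Arr C \<and> q \<in> Arr C \<and>
    Dom C f = Dom C g \<and> Cod C f = Cod C g \<and> Dom C q = Cod C f \<and>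
    q \<cdot>\<^bsub>C\<^esub> f = q \<cdot>\<^bsub>C\<^esub> g \<and>
    (\<forall>X. \<forall>u \<in> hom C (Cod C f) X. u \<cdot>\<^bsub>C\<^esub> f = u \<cdot>\<^bsub>C\<^esub> g \<longrightarrow>
      (\<exists>!w. w \<in> hom C (Cod C q) X \<and> w \<cdot>\<^bsub>C\<^esub> q = u))"

definition regular_epi :: "('o, 'a) cat \<Rightarrow> 'a \<Rightarrow> bool" where
  "regular_epi C q \<longleftrightarrow> (\<exists>f g. is_coequalizer C f g q)"

definition regular_category :: "('o, 'a) cat \<Rightarrow> bool" where
  "regular_category C \<longleftrightarrow> finitely_complete C \<and>
    (\<forall>f p q. is_pullback C f f p q \<longrightarrow> (\<exists>e. is_coequalizer C p q e)) \<and>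
    (\<forall>f g p q. is_pullback C f g p q \<longrightarrow> regular_epi C g \<longrightarrow> regular_epi C p)"

definition section_of :: "('o, 'a) cat \<Rightarrow> 'a \<Rightarrow> 'a \<Rightarrow> bool" where
  "section_of C p s \<longleftrightarrow> p \<in> Arr C \<and> s \<in> hom C (Cod C p) (Dom C p) \<and>
    p \<cdot>\<^bsub>C\<^esub> s = Ident C (Cod C p)"

definition jointly_extremally_epi :: "('o, 'a) cat \<Rightarrow> 'a \<Rightarrow> 'a \<Rightarrow> bool" where
  "jointly_extremally_epi C g s \<longleftrightarrow> g \<in> Arr C \<and> s \<in> Arr C \<and> Cod C g = Cod C s \<and>
    (\<forall>m. monic C m \<and> Cod C m = Cod C g \<and>
      (\<exists>g' \<in> hom C (Dom C g) (Dom C m). m \<cdot>\<^bsub>C\<^esub> g' = g) \<and>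
      (\<exists>s' \<in> hom C (Dom C s) (Dom C m). m \<cdot>\<^bsub>C\<^esub> s' = s) \<longrightarrow> is_iso C m)"

definition protomodular :: "('o, 'a) cat \<Rightarrow> bool" where
  "protomodular C \<longleftrightarrow> category C \<and>
    (\<forall>p s f. section_of C p s \<and> f \<in> Arr C \<and> Cod C f = Cod C p \<longrightarrow>
      (\<exists>h g. is_pullback C f p h g) \<and>
      (\<forall>h g. is_pullback C f p h g \<longrightarrow> jointly_extremally_epi C g s))"


section \<open>Functors and adjunctions\<close>

record ('o, 'a, 'p, 'b) cfunctor =
  fobj :: "'o \<Rightarrow> 'p"
  farr :: "'a \<Rightarrow> 'b"

definition is_functor :: "('o, 'a) cat \<Rightarrow> ('p, 'b) cat \<Rightarrow> ('o, 'a, 'p, 'b) cfunctor \<Rightarrow> bool" where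
  "is_functor C D H \<longleftrightarrow> category C \<and> category D \<and>
    (\<forall>A \<in> Obj C. fobj H A \<in> Obj D) \<and>
    (\<forall>f \<in> Arr C. farr H f \<in> hom D (fobj H (Dom C f)) (fobj H (Cod C f))) \<and>
    (\<forall>A \<in> Obj C. farr H (Ident C A) = Ident D (fobj H A)) \<and>
    (\<forall>f \<in> Arr C. \<forall>g \<in> Arr C. Dom C g = Cod C f \<longrightarrow>
      farr H (g \<cdot>\<^bsub>C\<^esub> f) = farr H g \<cdot>\<^bsub>D\<^esub> farr H f)"

definition full_functor :: "('o, 'a) cat \<Rightarrow> ('p, 'b) cat \<Rightarrow> ('o, 'a, 'p, 'b) cfunctor \<Rightarrow> bool" where
  "full_functor C D H \<longleftrightarrow> is_functor C D H \<and>
    (\<forall>A \<in> Obj C. \<forall>B \<in> Obj C. \<forall>k \<in> hom D (fobj H A) (fobj H B). \<exists>h \<in> hom C A B. farr H h = k)"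

definition faithful_functor :: "('o, 'a) cat \<Rightarrow> ('p, 'b) cat \<Rightarrow> ('o, 'a, 'p, 'b) cfunctor \<Rightarrow> bool" where
  "faithful_functor C D H \<longleftrightarrow> is_functor C D H \<and>
    (\<forall>A \<in> Obj C. \<forall>B \<in> Obj C. inj_on (farr H) (hom C A B))"

definition inclusion :: "('o, 'a, 'o, 'a) cfunctor" where
  "inclusion = \<lparr>fobj = (\<lambda>A. A), farr = (\<lambda>f. f)\<rparr>"

text \<open>\<open>adjunction C D L R \<eta> \<epsilon>\<close>: the functor \<open>L : C \<rightarrow> D\<close> is left adjoint to \<open>R : D \<rightarrow> C\<close>, with
  unit \<open>\<eta>\<close> and counit \<open>\<epsilon>\<close>.\<close>

definition adjunction :: "('o, 'a) cat \<Rightarrow> ('p, 'b) cat \<Rightarrow>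
    ('o, 'a, 'p, 'b) cfunctor \<Rightarrow> ('p, 'b, 'o, 'a) cfunctor \<Rightarrow> ('o \<Rightarrow> 'a) \<Rightarrow> ('p \<Rightarrow> 'b) \<Rightarrow> bool" where
  "adjunction C D L R \<eta> \<epsilon> \<longleftrightarrow> is_functor C D L \<and> is_functor D C R \<and>
    (\<forall>A \<in> Obj C. \<eta> A \<in> hom C A (fobj R (fobj L A))) \<and>
    (\<forall>f \<in> Arr C. \<eta> (Cod C f) \<cdot>\<^bsub>C\<^esub> f = farr R (farr L f) \<cdot>\<^bsub>C\<^esub> \<eta> (Dom C f)) \<and>
    (\<forall>B \<in> Obj D. \<epsilon> B \<in> hom D (fobj L (fobj R B)) B) \<and>
    (\<forall>g \<in> Arr D. \<epsilon> (Cod D g) \<cdot>\<^bsub>D\<^esub> farr L (farr R g) = g \<cdot>\<^bsub>D\<^esub> \<epsilon> (Dom D g)) \<and>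
    (\<forall>A \<in> Obj C. \<epsilon> (fobj L A) \<cdot>\<^bsub>D\<^esub> farr L (\<eta> A) = Ident D (fobj L A)) \<and>
    (\<forall>B \<in> Obj D. farr R (\<epsilon> B) \<cdot>\<^bsub>C\<^esub> \<eta> (fobj R B) = Ident C (fobj R B))"


section \<open>Zero objects and torsion theories\<close>

text \<open>\<open>Z\<close> is the set of objects of the class of zero objects; \<open>Zf\<close> is its coreflector, with
  counit \<open>\<epsilon>\<close>.\<close>

definition class_of_zero_objects :: "('o, 'a) cat \<Rightarrow> 'o set \<Rightarrow> ('o, 'a, 'o, 'a) cfunctor \<Rightarrow> ('o \<Rightarrow> 'a) \<Rightarrow> bool" where
  "class_of_zero_objects C Z Zf \<epsilon> \<longleftrightarrow> replete C Z \<and>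
    (\<forall>A \<in> Z. \<forall>B \<in> Z. \<forall>f \<in> hom C A B. \<forall>g \<in> hom C A B. f = g) \<and>
    (\<exists>\<eta>. adjunction (full_sub C Z) C inclusion Zf \<eta> \<epsilon>) \<and>
    (\<forall>A \<in> Obj C. monic C (\<epsilon> A)) \<and>
    (\<forall>m. monic C m \<longrightarrow> is_iso (full_sub C Z) (farr Zf m))"

definition null_arrows :: "('o, 'a) cat \<Rightarrow> 'o set \<Rightarrow> 'a set" where
  "null_arrows C Z = {f \<in> Arr C. \<exists>W \<in> Z. \<exists>u \<in> hom C (Dom C f) W. \<exists>v \<in> hom C W (Cod C f). f = v \<cdot>\<^bsub>C\<^esub> u}"

definition Z_kernel :: "('o, 'a) cat \<Rightarrow> 'o set \<Rightarrow> 'a \<Rightarrow> 'a \<Rightarrow> bool" where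
  "Z_kernel C Z f k \<longleftrightarrow> f \<in> Arr C \<and> k \<in> Arr C \<and> Cod C k = Dom C f \<and>
    f \<cdot>\<^bsub>C\<^esub> k \<in> null_arrows C Z \<and>
    (\<forall>E. \<forall>e \<in> hom C E (Dom C f). f \<cdot>\<^bsub>C\<^esub> e \<in> null_arrows C Z \<longrightarrow>
      (\<exists>!w. w \<in> hom C E (Dom C k) \<and> k \<cdot>\<^bsub>C\<^esub> w = e))"

definition Z_cokernel :: "('o, 'a) cat \<Rightarrow> 'o set \<Rightarrow> 'a \<Rightarrow> 'a \<Rightarrow> bool" where
  "Z_cokernel C Z f q \<longleftrightarrow> f \<in> Arr C \<and> q \<in> Arr C \<and> Dom C q = Cod C f \<and>
    q \<cdot>\<^bsub>C\<^esub> f \<in> null_arrows C Z \<and>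
    (\<forall>E. \<forall>e \<in> hom C (Cod C f) E. e \<cdot>\<^bsub>C\<^esub> f \<in> null_arrows C Z \<longrightarrow>
      (\<exists>!w. w \<in> hom C (Cod C q) E \<and> w \<cdot>\<^bsub>C\<^esub> q = e))"

definition short_Z_exact :: "('o, 'a) cat \<Rightarrow> 'o set \<Rightarrow> 'a \<Rightarrow> 'a \<Rightarrow> bool" where
  "short_Z_exact C Z f g \<longleftrightarrow> Z_kernel C Z g f \<and> Z_cokernel C Z f g"

text \<open>The torsion and torsion-free subcategories are given by their sets of objects \<open>\<T>\<close> and \<open>\<F>\<close>,
  and \<open>t\<close> and \<open>\<eta>\<close> choose a short exact sequence for every object \<open>A\<close>, so that the torsion part of
  \<open>A\<close> is \<open>Dom C (t A)\<close> and its torsion-free part is \<open>Cod C (\<eta> A)\<close>.\<close>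

definition Z_torsion_theory ::
    "('o, 'a) cat \<Rightarrow> 'o set \<Rightarrow> 'o set \<Rightarrow> 'o set \<Rightarrow> ('o \<Rightarrow> 'a) \<Rightarrow> ('o \<Rightarrow> 'a) \<Rightarrow> bool" where
  "Z_torsion_theory C Z \<T> \<F> t \<eta> \<longleftrightarrow> replete C \<T> \<and> replete C \<F> \<and> \<T> \<inter> \<F> = Z \<and>
    (\<forall>T \<in> \<T>. \<forall>F \<in> \<F>. hom C T F \<subseteq> null_arrows C Z) \<and>
    (\<forall>A \<in> Obj C. Cod C (t A) = A \<and> Dom C (\<eta> A) = A \<and> Dom C (t A) \<in> \<T> \<and> Cod C (\<eta> A) \<in> \<F> \<and>
      short_Z_exact C Z (t A) (\<eta> A))"

text \<open>In the next two definitions \<open>R\<close> is the reflector onto the torsion-free subcategory.\<close>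

definition condition_M' ::
    "('o, 'a) cat \<Rightarrow> ('o, 'a, 'o, 'a) cfunctor \<Rightarrow> ('o \<Rightarrow> 'a) \<Rightarrow> ('o, 'a, 'o, 'a) cfunctor \<Rightarrow> bool" where
  "condition_M' C Zf t R \<longleftrightarrow>
    (\<forall>A \<in> Obj C. isomorphic C (fobj R (Dom C (t A))) (fobj Zf (fobj R A)))"

text \<open>"\<open>\<chi>\<close> is \<open>\<eta>\<close> at \<open>T'\<close> up to isomorphism" is read as: \<open>\<chi>\<close> is that
  component followed by an isomorphism \<open>R(T') \<cong> Z'\<close>.\<close>

definition condition_S ::
    "('o, 'a) cat \<Rightarrow> 'o set \<Rightarrow> 'o set \<Rightarrow> ('o, 'a, 'o, 'a) cfunctor \<Rightarrow> ('o \<Rightarrow> 'a) \<Rightarrow> bool" where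
  "condition_S C Z \<T> R \<eta> \<longleftrightarrow>
    (\<forall>T \<in> \<T>. \<forall>Z' \<in> Z. \<forall>z \<in> hom C Z' (fobj R T). \<forall>\<chi> q. is_pullback C z (\<eta> T) \<chi> q \<longrightarrow>
      Dom C \<chi> \<in> \<T> \<and>
      (\<exists>i \<in> hom C (fobj R (Dom C \<chi>)) Z'. is_iso C i \<and> \<chi> = i \<cdot>\<^bsub>C\<^esub> \<eta> (Dom C \<chi>)))"


section \<open>Admissible Galois structures\<close>

definition admissible_class :: "('o, 'a) cat \<Rightarrow> 'a set \<Rightarrow> bool" where
  "admissible_class C \<A> \<longleftrightarrow> \<A> \<subseteq> Arr C \<and>
    (\<forall>f. is_iso C f \<longrightarrow> f \<in> \<A>) \<and>
    (\<forall>f \<in> \<A>. \<forall>g \<in> \<A>. Dom C g = Cod C f \<longrightarrow> g \<cdot>\<^bsub>C\<^esub> f \<in> \<A>) \<and>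
    (\<forall>f \<in> \<A>. \<forall>g \<in> \<A>. \<forall>p q. is_pullback C f g p q \<longrightarrow> p \<in> \<A> \<and> q \<in> \<A>)"

text \<open>Here \<open>S : A \<rightarrow> P\<close> is the left adjoint and \<open>G : P \<rightarrow> A\<close> the right adjoint; \<open>\<A>\<close> and \<open>\<P>\<close> are the
  distinguished classes of arrows of \<open>A\<close> and \<open>P\<close>.\<close>

definition relatively_admissible_adjunction :: "('o, 'a) cat \<Rightarrow> ('p, 'b) cat \<Rightarrow>
    ('o, 'a, 'p, 'b) cfunctor \<Rightarrow> ('p, 'b, 'o, 'a) cfunctor \<Rightarrow> ('o \<Rightarrow> 'a) \<Rightarrow> ('p \<Rightarrow> 'b) \<Rightarrow>
    'a set \<Rightarrow> 'b set \<Rightarrow> bool" where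
  "relatively_admissible_adjunction A P S G \<eta> \<epsilon> \<A> \<P> \<longleftrightarrow>
    adjunction A P S G \<eta> \<epsilon> \<and> has_pullbacks A \<and> has_pullbacks P \<and>
    admissible_class A \<A> \<and> admissible_class P \<P> \<and>
    farr S ` \<A> \<subseteq> \<P> \<and> farr G ` \<P> \<subseteq> \<A> \<and>
    (\<forall>X \<in> Obj A. \<eta> X \<in> \<A>) \<and> (\<forall>Y \<in> Obj P. \<epsilon> Y \<in> \<P>)"

definition chosen_pullback :: "('o, 'a) cat \<Rightarrow> 'a \<Rightarrow> 'a \<Rightarrow> 'a \<times> 'a" where
  "chosen_pullback C f g = (SOME (p, q). is_pullback C f g p q)"

text \<open>The functor from \<open>\<P>/S(X)\<close> to \<open>\<A>/X\<close> which sends \<open>g\<close> to the (chosen) pullback of \<open>G(g)\<close> along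
  the unit \<open>\<eta> X\<close>, and a morphism \<open>h\<close> of the slice to the induced arrow between the pullbacks.\<close>

definition slice_right_adjoint :: "('o, 'a) cat \<Rightarrow> ('p, 'b, 'o, 'a) cfunctor \<Rightarrow> ('o \<Rightarrow> 'a) \<Rightarrow> 'o \<Rightarrow>
    ('b, 'b \<times> 'b \<times> 'b, 'a, 'a \<times> 'a \<times> 'a) cfunctor" where
  "slice_right_adjoint A G \<eta> X =
    \<lparr>fobj = (\<lambda>g. fst (chosen_pullback A (\<eta> X) (farr G g))),
     farr = (\<lambda>(g, g', h).
       let (p, q) = chosen_pullback A (\<eta> X) (farr G g);
           (p', q') = chosen_pullback A (\<eta> X) (farr G g')
       in (p, p', THE w. w \<in> hom A (Dom A p) (Dom A p') \<and>
                         p' \<cdot>\<^bsub>A\<^esub> w = p \<and> q' \<cdot>\<^bsub>A\<^esub> w = farr G h \<cdot>\<^bsub>A\<^esub> q))\<rparr>"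

definition admissible_galois_structure :: "('o, 'a) cat \<Rightarrow> ('p, 'b) cat \<Rightarrow>
    ('o, 'a, 'p, 'b) cfunctor \<Rightarrow> ('p, 'b, 'o, 'a) cfunctor \<Rightarrow> ('o \<Rightarrow> 'a) \<Rightarrow> ('p \<Rightarrow> 'b) \<Rightarrow>
    'a set \<Rightarrow> 'b set \<Rightarrow> bool" where
  "admissible_galois_structure A P S G \<eta> \<epsilon> \<A> \<P> \<longleftrightarrow>
    relatively_admissible_adjunction A P S G \<eta> \<epsilon> \<A> \<P> \<and>
    (\<forall>X \<in> Obj A.
      full_functor (slice_on P \<P> (fobj S X)) (slice_on A \<A> X) (slice_right_adjoint A G \<eta> X) \<and>
      faithful_functor (slice_on P \<P> (fobj S X)) (slice_on A \<A> X) (slice_right_adjoint A G \<eta> X))"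

end

theory Submission
  imports Defs
begin

text \<open>
  Full faithfulness of the slice functors amounts to the following: if \<open>q : P \<rightarrow> B\<close> is the pullback
  of \<open>\<eta>\<^sub>X\<close> along an arrow \<open>g : B \<rightarrow> F X\<close> with \<open>B\<close> torsion-free, then \<open>q\<close> is a reflection of \<open>P\<close>, that
  is, in \<open>q = m \<cdot> \<eta>\<^sub>P\<close> the arrow \<open>m : F P \<rightarrow> B\<close> is invertible. The components of \<open>\<eta>\<close> are regular epis,
  because monos do not change the coreflection into the zero objects, and so \<open>q\<close> and \<open>m\<close> are strong
  epis. By protomodularity, \<open>m\<close> is a mono as soon as its pullback \<open>n : N \<rightarrow> Z B\<close> along the mono
  \<open>Z B \<rightarrow> B\<close> is. Let \<open>\<chi> : T' \<rightarrow> Z B\<close> be the pullback of \<open>q\<close> along \<open>Z B \<rightarrow> B\<close>. It is also a pullback of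
  \<open>T X \<rightarrow> Z (F X)\<close>, which is the reflection of \<open>T X\<close> by (M'), so \<open>\<chi>\<close> is a reflection of \<open>T'\<close> by (S).
  Now \<open>\<chi> = n \<cdot> a\<close>, where \<open>a : T' \<rightarrow> N\<close> is a pullback of \<open>\<eta>\<^sub>P\<close>, hence a regular epi, and \<open>N\<close> is
  torsion-free, being a subobject of \<open>F P\<close>. Thus \<open>a\<close> factors through \<open>\<chi>\<close>, which makes \<open>n\<close> invertible.
\<close>

section \<open>Basic category theory\<close>

text \<open>\<open>category\<close> admits record extensions, whereas \<open>full_sub\<close>,
  \<open>slice\<close> and \<open>is_pullback\<close> are defined for the bare record only. Fixing
  the type here makes them applicable to \<open>C\<close>.\<close>

locale plain_category = category C for C :: "('o, 'a) cat" (structure)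
begin

text \<open>The axioms are restated with explicit domains and codomains instead of
  \<open>hom\<close>, so that simplification can check composability and reassociate to the
  right.\<close>

lemma Comp_arr:
  assumes "f \<in> Arr C" "g \<in> Arr C" "Dom C g = Cod C f"
  shows Comp_Arr [simp]: "g \<cdot> f \<in> Arr C"
    and Dom_Comp [simp]: "Dom C (g \<cdot> f) = Dom C f"
    and Cod_Comp [simp]: "Cod C (g \<cdot> f) = Cod C g"
  using Comp_hom[of f "Dom C f" "Cod C f" g "Cod C g"] assms by (auto simp: hom_def)

lemma Comp_assoc' [simp]:
  assumes "f \<in> Arr C" "g \<in> Arr C" "h \<in> Arr C" "Dom C g = Cod C f" "Dom C h = Cod C g"
  shows "(h \<cdot> g) \<cdot> f = h \<cdot> (g \<cdot> f)"
  using Comp_assoc assms by (auto simp: hom_def)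

lemma Ident_simps [simp]:
  assumes "A \<in> Obj C"
  shows "Ident C A \<in> Arr C" "Dom C (Ident C A) = A" "Cod C (Ident C A) = A"
  using Ident_hom[OF assms] by (auto simp: hom_def)

lemma Comp_Ident' [simp]: "f \<in> Arr C \<Longrightarrow> Dom C f = A \<Longrightarrow> f \<cdot> Ident C A = f"
  using Comp_Ident by (auto simp: hom_def)

lemma Ident_Comp' [simp]: "f \<in> Arr C \<Longrightarrow> Cod C f = A \<Longrightarrow> Ident C A \<cdot> f = f"
  using Ident_Comp by (auto simp: hom_def)

lemma homI: "f \<in> Arr C \<Longrightarrow> Dom C f = A \<Longrightarrow> Cod C f = B \<Longrightarrow> f \<in> hom C A B"
  by (simp add: hom_def)

text \<open>Composites are normalised to the right, so the left side of a commutative square is no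
  longer visible once a further arrow is precomposed. This lemma and the next one rewrite with a
  square or a triangle in that position.\<close>

lemma Comp_eq_right:
  assumes "a \<cdot> b = c \<cdot> d" "x \<in> Arr C" "a \<in> Arr C" "b \<in> Arr C" "c \<in> Arr C" "d \<in> Arr C"
    "Dom C a = Cod C b" "Dom C c = Cod C d" "Dom C b = Cod C x" "Dom C d = Cod C x"
  shows "a \<cdot> (b \<cdot> x) = c \<cdot> (d \<cdot> x)"
proof -
  have "a \<cdot> (b \<cdot> x) = (a \<cdot> b) \<cdot> x" using assms(2-) by simp
  also have "\<dots> = c \<cdot> (d \<cdot> x)" using assms by simp
  finally show ?thesis .
qed

lemma Comp_eq_right1:
  assumes "a \<cdot> b = c" "x \<in> Arr C" "a \<in> Arr C" "b \<in> Arr C" "Dom C a = Cod C b" "Dom C b = Cod C x"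
  shows "a \<cdot> (b \<cdot> x) = c \<cdot> x"
  using assms by (simp flip: assms(1))

section \<open>Monomorphisms and isomorphisms\<close>

lemma monicD:
  assumes "monic C m" "u \<in> Arr C" "v \<in> Arr C" "Dom C u = Dom C v" "Cod C u = Dom C m"
    "Cod C v = Dom C m" "m \<cdot> u = m \<cdot> v"
  shows "u = v"
  using assms unfolding monic_def hom_def by blast

lemma monicI:
  assumes "m \<in> Arr C"
    "\<And>u v. \<lbrakk>u \<in> Arr C; v \<in> Arr C; Dom C u = Dom C v; Cod C u = Dom C m; Cod C v = Dom C m;
      m \<cdot> u = m \<cdot> v\<rbrakk> \<Longrightarrow> u = v"
  shows "monic C m"
  using assms unfolding monic_def hom_def by auto

lemma monic_Arr: "monic C m \<Longrightarrow> m \<in> Arr C"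
  by (simp add: monic_def)

lemma is_isoE:
  assumes "is_iso C f"
  obtains g where "f \<in> Arr C" "g \<in> Arr C" "Dom C g = Cod C f" "Cod C g = Dom C f"
    "g \<cdot> f = Ident C (Dom C f)" "f \<cdot> g = Ident C (Cod C f)"
  using assms unfolding is_iso_def hom_def by auto

lemma is_isoI:
  assumes "f \<in> Arr C" "g \<in> Arr C" "Dom C g = Cod C f" "Cod C g = Dom C f"
    "g \<cdot> f = Ident C (Dom C f)" "f \<cdot> g = Ident C (Cod C f)"
  shows "is_iso C f"
  using assms unfolding is_iso_def hom_def by auto

lemma split_monic:
  assumes "m \<in> Arr C" "r \<in> Arr C" "Dom C r = Cod C m" "r \<cdot> m = Ident C (Dom C m)"
  shows "monic C m"
proof (rule monicI[OF assms(1)])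
  fix u v assume uv: "u \<in> Arr C" "v \<in> Arr C" "Dom C u = Dom C v" "Cod C u = Dom C m"
    "Cod C v = Dom C m" "m \<cdot> u = m \<cdot> v"
  have "r \<cdot> (m \<cdot> x) = x" if "x \<in> Arr C" "Cod C x = Dom C m" for x
    using Comp_eq_right1[OF assms(4)] assms that by simp
  then show "u = v" using uv by metis
qed

lemma iso_monic: "is_iso C m \<Longrightarrow> monic C m"
  by (elim is_isoE) (rule split_monic)

lemma isomorphic_sym: "isomorphic C A B \<Longrightarrow> isomorphic C B A"
  unfolding isomorphic_def is_iso_def hom_def by fastforce

lemma monic_Comp:
  assumes "monic C m" "monic C n" "Dom C n = Cod C m"
  shows "monic C (n \<cdot> m)"
proof (rule monicI)
  show "n \<cdot> m \<in> Arr C" using assms monic_Arr by simp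
next
  fix u v assume uv: "u \<in> Arr C" "v \<in> Arr C" "Dom C u = Dom C v" "Cod C u = Dom C (n \<cdot> m)"
    "Cod C v = Dom C (n \<cdot> m)" "(n \<cdot> m) \<cdot> u = (n \<cdot> m) \<cdot> v"
  have "m \<cdot> u = m \<cdot> v"
    by (rule monicD[OF assms(2)]) (use uv assms monic_Arr in auto)
  then show "u = v"
    by (rule monicD[OF assms(1), rotated -1]) (use uv assms monic_Arr in auto)
qed

lemma monic_of_Comp:
  assumes "monic C (n \<cdot> m)" "m \<in> Arr C" "n \<in> Arr C" "Dom C n = Cod C m"
  shows "monic C m"
proof (rule monicI[OF assms(2)])
  fix u v assume uv: "u \<in> Arr C" "v \<in> Arr C" "Dom C u = Dom C v" "Cod C u = Dom C m"
    "Cod C v = Dom C m" "m \<cdot> u = m \<cdot> v"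
  show "u = v"
    by (rule monicD[OF assms(1)]) (use uv assms in auto)
qed

section \<open>Pullbacks\<close>

lemma is_pullbackD:
  assumes "is_pullback C f g p q"
  shows "f \<in> Arr C" "g \<in> Arr C" "p \<in> Arr C" "q \<in> Arr C" "Cod C f = Cod C g"
    "Dom C p = Dom C q" "Cod C p = Dom C f" "Cod C q = Dom C g" "f \<cdot> p = g \<cdot> q"
  using assms unfolding is_pullback_def by auto

lemma pullback_lift:
  assumes "is_pullback C f g p q" "u \<in> Arr C" "v \<in> Arr C" "Dom C u = Dom C v"
    "Cod C u = Dom C f" "Cod C v = Dom C g" "f \<cdot> u = g \<cdot> v"
  obtains w where "w \<in> Arr C" "Dom C w = Dom C u" "Cod C w = Dom C p" "p \<cdot> w = u" "q \<cdot> w = v"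
proof -
  have "u \<in> hom C (Dom C u) (Dom C f)" "v \<in> hom C (Dom C u) (Dom C g)"
    using assms by (auto simp: hom_def)
  then have "\<exists>!w. w \<in> hom C (Dom C u) (Dom C p) \<and> p \<cdot> w = u \<and> q \<cdot> w = v"
    using assms unfolding is_pullback_def by blast
  then show thesis using that by (auto simp: hom_def)
qed

lemma pullback_cancel:
  assumes pb: "is_pullback C f g p q" and w: "w \<in> Arr C" "w' \<in> Arr C" "Dom C w = Dom C w'"
    "Cod C w = Dom C p" "Cod C w' = Dom C p" "p \<cdot> w = p \<cdot> w'" "q \<cdot> w = q \<cdot> w'"
  shows "w = w'"
proof -
  note d = is_pullbackD[OF pb]
  have "p \<cdot> w \<in> hom C (Dom C w) (Dom C f)" "q \<cdot> w \<in> hom C (Dom C w) (Dom C g)"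
    using d w by (auto simp: hom_def)
  moreover have "f \<cdot> (p \<cdot> w) = g \<cdot> (q \<cdot> w)"
    by (rule Comp_eq_right) (use d w in auto)
  ultimately have "\<exists>!x. x \<in> hom C (Dom C w) (Dom C p) \<and> p \<cdot> x = p \<cdot> w \<and> q \<cdot> x = q \<cdot> w"
    using pb unfolding is_pullback_def by blast
  then show ?thesis using w unfolding hom_def by (metis (mono_tags, lifting) mem_Collect_eq)
qed

text \<open>The unique existence in the definition is split into lifting of cones and joint monicity
  of the projections, the two halves given by \<open>pullback_lift\<close> and
  \<open>pullback_cancel\<close>.\<close>

lemma is_pullbackI:
  assumes "f \<in> Arr C" "g \<in> Arr C" "p \<in> Arr C" "q \<in> Arr C" "Cod C f = Cod C g"
    "Dom C p = Dom C q" "Cod C p = Dom C f" "Cod C q = Dom C g" "f \<cdot> p = g \<cdot> q"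
    and ex: "\<And>u v. \<lbrakk>u \<in> Arr C; v \<in> Arr C; Dom C u = Dom C v; Cod C u = Dom C f; Cod C v = Dom C g;
      f \<cdot> u = g \<cdot> v\<rbrakk> \<Longrightarrow>
      \<exists>w. w \<in> Arr C \<and> Dom C w = Dom C u \<and> Cod C w = Dom C p \<and> p \<cdot> w = u \<and> q \<cdot> w = v"
    and un: "\<And>w w'. \<lbrakk>w \<in> Arr C; w' \<in> Arr C; Dom C w = Dom C w'; Cod C w = Dom C p; Cod C w' = Dom C p;
      p \<cdot> w = p \<cdot> w'; q \<cdot> w = q \<cdot> w'\<rbrakk> \<Longrightarrow> w = w'"
  shows "is_pullback C f g p q"
  unfolding is_pullback_def
proof (intro conjI allI ballI impI)
  fix X u v assume u: "u \<in> hom C X (Dom C f)" and v: "v \<in> hom C X (Dom C g)" and e: "f \<cdot> u = g \<cdot> v"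
  obtain w where w: "w \<in> Arr C" "Dom C w = Dom C u" "Cod C w = Dom C p" "p \<cdot> w = u" "q \<cdot> w = v"
    using ex[OF _ _ _ _ _ e] u v by (auto simp: hom_def)
  show "\<exists>!w. w \<in> hom C X (Dom C p) \<and> p \<cdot> w = u \<and> q \<cdot> w = v"
  proof (rule ex1I[of _ w])
    show "w \<in> hom C X (Dom C p) \<and> p \<cdot> w = u \<and> q \<cdot> w = v" using w u by (auto simp: hom_def)
  next
    fix w' assume "w' \<in> hom C X (Dom C p) \<and> p \<cdot> w' = u \<and> q \<cdot> w' = v"
    then show "w' = w" using un[of w' w] w u by (auto simp: hom_def)
  qed
qed (use assms(1-9) in auto)

lemma is_pullback_sym:
  assumes pb: "is_pullback C f g p q"
  shows "is_pullback C g f q p"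
proof (rule is_pullbackI)
  note d = is_pullbackD[OF pb]
  fix u v assume uv: "u \<in> Arr C" "v \<in> Arr C" "Dom C u = Dom C v" "Cod C u = Dom C g" "Cod C v = Dom C f"
    "g \<cdot> u = f \<cdot> v"
  obtain w where "w \<in> Arr C" "Dom C w = Dom C v" "Cod C w = Dom C p" "p \<cdot> w = v" "q \<cdot> w = u"
    by (rule pullback_lift[OF pb uv(2,1) _ uv(5,4)]) (use uv in auto)
  then show "\<exists>w. w \<in> Arr C \<and> Dom C w = Dom C u \<and> Cod C w = Dom C q \<and> q \<cdot> w = u \<and> p \<cdot> w = v"
    using uv(3) d(6) by auto
qed (use is_pullbackD[OF pb] pullback_cancel[OF pb] in auto)

lemma pullback_monic:
  assumes pb: "is_pullback C f g p q" and "monic C f"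
  shows "monic C q"
proof (rule monicI)
  note d = is_pullbackD[OF pb]
  show "q \<in> Arr C" by (rule d)
  fix u v assume uv: "u \<in> Arr C" "v \<in> Arr C" "Dom C u = Dom C v" "Cod C u = Dom C q"
    "Cod C v = Dom C q" "q \<cdot> u = q \<cdot> v"
  have "f \<cdot> (p \<cdot> u) = g \<cdot> (q \<cdot> u)" by (rule Comp_eq_right) (use d uv in auto)
  also have "\<dots> = f \<cdot> (p \<cdot> v)" unfolding uv(6) by (rule Comp_eq_right) (use d uv in auto)
  finally have "p \<cdot> u = p \<cdot> v"
    by (rule monicD[OF assms(2), rotated -1]) (use d uv in auto)
  then show "u = v" by (rule pullback_cancel[OF pb, rotated -2]) (use d uv in auto)
qed

text \<open>Cancellation half of the pasting law. A cone \<open>(u, v)\<close> on the left square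
  gives the cone \<open>(n \<cdot> u, v)\<close> on the outer rectangle, and its lift is compared
  with \<open>u\<close> through the jointly monic pair \<open>n\<close>, \<open>l\<close>.\<close>

lemma pullback_left_cancel:
  assumes outer: "is_pullback C f (g \<cdot> h) p k" and right: "is_pullback C f g n l"
    and h: "h \<in> Arr C" "Cod C h = Dom C g"
    and a: "a \<in> Arr C" "Dom C a = Dom C p" "Cod C a = Dom C n" "n \<cdot> a = p" "l \<cdot> a = h \<cdot> k"
  shows "is_pullback C l h a k"
proof -
  note d = is_pullbackD[OF outer] and e = is_pullbackD[OF right]
  have dk: "Cod C k = Dom C h" using d e h by simp
  show ?thesis
  proof (rule is_pullbackI)
    fix u v assume uv: "u \<in> Arr C" "v \<in> Arr C" "Dom C u = Dom C v" "Cod C u = Dom C l"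
      "Cod C v = Dom C h" "l \<cdot> u = h \<cdot> v"
    have "f \<cdot> (n \<cdot> u) = g \<cdot> (l \<cdot> u)" by (rule Comp_eq_right) (use e uv in auto)
    then have "f \<cdot> (n \<cdot> u) = (g \<cdot> h) \<cdot> v" using uv e h by simp
    then obtain w where w: "w \<in> Arr C" "Dom C w = Dom C (n \<cdot> u)" "Cod C w = Dom C p"
        "p \<cdot> w = n \<cdot> u" "k \<cdot> w = v"
      by (rule pullback_lift[OF outer, rotated -2]) (use d e uv h in auto)
    have "n \<cdot> (a \<cdot> w) = p \<cdot> w" by (rule Comp_eq_right1) (use a w e in auto)
    then have 1: "n \<cdot> (a \<cdot> w) = n \<cdot> u" using w by simp
    have "l \<cdot> (a \<cdot> w) = h \<cdot> (k \<cdot> w)" by (rule Comp_eq_right) (use a w e d h dk in auto)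
    then have 2: "l \<cdot> (a \<cdot> w) = l \<cdot> u" using w uv by simp
    have "a \<cdot> w = u" by (rule pullback_cancel[OF right _ _ _ _ _ 1 2]) (use a w e uv in auto)
    then show "\<exists>w. w \<in> Arr C \<and> Dom C w = Dom C u \<and> Cod C w = Dom C a \<and> a \<cdot> w = u \<and> k \<cdot> w = v"
      using w a e uv by auto
  next
    fix w w' assume w: "w \<in> Arr C" "w' \<in> Arr C" "Dom C w = Dom C w'" "Cod C w = Dom C a"
      "Cod C w' = Dom C a" "a \<cdot> w = a \<cdot> w'" "k \<cdot> w = k \<cdot> w'"
    have "p \<cdot> w = p \<cdot> w'"
      using Comp_eq_right1[OF a(4), of w] Comp_eq_right1[OF a(4), of w'] w a e by simp
    then show "w = w'" by (rule pullback_cancel[OF outer, rotated -2]) (use w a in auto)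
  qed (use a d e h dk in auto)
qed

section \<open>Coequalizers and regular epimorphisms\<close>

lemma is_coequalizerD:
  assumes "is_coequalizer C f g q"
  shows "f \<in> Arr C" "g \<in> Arr C" "q \<in> Arr C" "Dom C f = Dom C g" "Cod C f = Cod C g"
    "Dom C q = Cod C f" "q \<cdot> f = q \<cdot> g"
  using assms unfolding is_coequalizer_def by auto

lemma coequalizer_factor:
  assumes "is_coequalizer C f g q" "u \<in> Arr C" "Dom C u = Cod C f" "u \<cdot> f = u \<cdot> g"
  obtains w where "w \<in> Arr C" "Dom C w = Cod C q" "Cod C w = Cod C u" "w \<cdot> q = u"
proof -
  have "u \<in> hom C (Cod C f) (Cod C u)" using assms by (auto simp: hom_def)
  then have "\<exists>!w. w \<in> hom C (Cod C q) (Cod C u) \<and> w \<cdot> q = u"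
    using assms(1,4) by (simp add: is_coequalizer_def)
  then show thesis using that by (auto simp: hom_def)
qed

lemma regular_epi_Arr: "regular_epi C q \<Longrightarrow> q \<in> Arr C"
  unfolding regular_epi_def is_coequalizer_def by auto

lemma regular_epi_cancel:
  assumes "regular_epi C q" and w: "w \<in> Arr C" "w' \<in> Arr C" "Cod C w = Cod C w'"
    "Dom C w = Cod C q" "Dom C w' = Cod C q" "w \<cdot> q = w' \<cdot> q"
  shows "w = w'"
proof -
  obtain f g where c: "is_coequalizer C f g q" using assms(1) unfolding regular_epi_def by auto
  note d = is_coequalizerD[OF c]
  have "w \<cdot> q \<in> hom C (Cod C f) (Cod C w)" using d w by (auto simp: hom_def)
  moreover have "(w \<cdot> q) \<cdot> f = (w \<cdot> q) \<cdot> g" using d w by simp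
  ultimately have "\<exists>!x. x \<in> hom C (Cod C q) (Cod C w) \<and> x \<cdot> q = w \<cdot> q"
    using c by (simp add: is_coequalizer_def)
  then show ?thesis using w unfolding hom_def by (metis (mono_tags, lifting) mem_Collect_eq)
qed

text \<open>If \<open>m \<cdot> x\<close> coequalizes \<open>f\<close> and \<open>g\<close>, so does
  \<open>x\<close>, because \<open>m\<close> is monic. Hence \<open>x\<close> factors through
  \<open>m \<cdot> x\<close>, and the factor \<open>w\<close> is inverse to
  \<open>m\<close>.\<close>

lemma regular_epi_strong:
  assumes "regular_epi C (m \<cdot> x)" "monic C m" "x \<in> Arr C" "Dom C m = Cod C x"
  shows "is_iso C m"
proof -
  obtain f g where c: "is_coequalizer C f g (m \<cdot> x)" using assms(1) unfolding regular_epi_def by auto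
  note d = is_coequalizerD[OF c] and m = monic_Arr[OF assms(2)]
  have dx: "Dom C x = Cod C f" using d m assms by simp
  have "m \<cdot> (x \<cdot> f) = m \<cdot> (x \<cdot> g)" using d m assms dx by simp
  then have "x \<cdot> f = x \<cdot> g"
    by (rule monicD[OF assms(2), rotated -1]) (use d m assms dx in auto)
  then obtain w where w: "w \<in> Arr C" "Dom C w = Cod C (m \<cdot> x)" "Cod C w = Cod C x" "w \<cdot> (m \<cdot> x) = x"
    by (rule coequalizer_factor[OF c, rotated -2]) (use d assms dx in auto)
  have dw: "Dom C w = Cod C m" using w m assms by simp
  have O: "Cod C m \<in> Obj C" "Dom C m \<in> Obj C" using m Dom_Obj Cod_Obj by auto
  have "(m \<cdot> w) \<cdot> (m \<cdot> x) = Ident C (Cod C m) \<cdot> (m \<cdot> x)"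
    using w m assms dw O by simp
  then have mw: "m \<cdot> w = Ident C (Cod C m)"
    by (rule regular_epi_cancel[OF assms(1), rotated -1]) (use w m assms dw O in auto)
  have "m \<cdot> (w \<cdot> m) = m \<cdot> Ident C (Dom C m)"
    using Comp_eq_right1[OF mw, of m] w m assms dw O by simp
  then have "w \<cdot> m = Ident C (Dom C m)"
    by (rule monicD[OF assms(2), rotated -1]) (use w m assms dw O in auto)
  then show ?thesis using mw by (rule is_isoI[rotated -2]) (use w m assms dw in auto)
qed

lemma regular_epi_monic_iso:
  assumes "regular_epi C m" "monic C m"
  shows "is_iso C m"
proof -
  have m: "m \<in> Arr C" using assms monic_Arr by simp
  then show ?thesis
    using regular_epi_strong[of m "Ident C (Dom C m)"] assms Dom_Obj by simp
qed

text \<open>A coequalizer followed by an isomorphism is a coequalizer of the same pair.\<close>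

lemma regular_epi_iso_Comp:
  assumes "regular_epi C e" "is_iso C m" "Dom C m = Cod C e"
  shows "regular_epi C (m \<cdot> e)"
proof -
  obtain f g where c: "is_coequalizer C f g e" using assms(1) unfolding regular_epi_def by auto
  note d = is_coequalizerD[OF c]
  obtain n where n: "m \<in> Arr C" "n \<in> Arr C" "Dom C n = Cod C m" "Cod C n = Dom C m"
    "n \<cdot> m = Ident C (Dom C m)" "m \<cdot> n = Ident C (Cod C m)" by (rule is_isoE[OF assms(2)])
  have O: "Cod C m \<in> Obj C" "Dom C m \<in> Obj C" "Cod C e \<in> Obj C" using n d Dom_Obj Cod_Obj by auto
  have "is_coequalizer C f g (m \<cdot> e)"
    unfolding is_coequalizer_def
  proof (intro conjI allI ballI impI)
    fix X u assume u: "u \<in> hom C (Cod C f) X" and uf: "u \<cdot> f = u \<cdot> g"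
    obtain w where w: "w \<in> Arr C" "Dom C w = Cod C e" "Cod C w = Cod C u" "w \<cdot> e = u"
      by (rule coequalizer_factor[OF c, of u]) (use u uf in \<open>auto simp: hom_def\<close>)
    have nm: "n \<cdot> (m \<cdot> e) = e" using Comp_eq_right1[OF n(5), of e] n d assms O by simp
    show "\<exists>!w. w \<in> hom C (Cod C (m \<cdot> e)) X \<and> w \<cdot> (m \<cdot> e) = u"
    proof (rule ex1I[of _ "w \<cdot> n"])
      show "w \<cdot> n \<in> hom C (Cod C (m \<cdot> e)) X \<and> (w \<cdot> n) \<cdot> (m \<cdot> e) = u"
        using u w n d assms nm by (auto simp: hom_def)
    next
      fix v assume v: "v \<in> hom C (Cod C (m \<cdot> e)) X \<and> v \<cdot> (m \<cdot> e) = u"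
      have v': "v \<in> Arr C" "Dom C v = Cod C m" "Cod C v = X" using v n d assms by (auto simp: hom_def)
      have "(v \<cdot> m) \<cdot> e = w \<cdot> e" using v v' w n d assms by simp
      then have "v \<cdot> m = w"
        by (rule regular_epi_cancel[OF assms(1), rotated -1])
          (use v' w n d assms u in \<open>auto simp: hom_def\<close>)
      then have "w \<cdot> n = v \<cdot> (m \<cdot> n)" using v' n by (simp flip: \<open>v \<cdot> m = w\<close>)
      then show "v = w \<cdot> n" using v' n by simp
    qed
  qed (use d n assms in auto)
  then show ?thesis unfolding regular_epi_def by auto
qed

end

section \<open>Regular protomodular categories\<close>

locale regular_cat = plain_category C for C :: "('o, 'a) cat" (structure) +
  assumes regular: "regular_category C"
begin

lemma pullback_exists:
  assumes "f \<in> Arr C" "g \<in> Arr C" "Cod C f = Cod C g"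
  obtains p q where "is_pullback C f g p q"
  using assms regular unfolding regular_category_def finitely_complete_def has_pullbacks_def by blast

lemma regular_epi_pullback:
  "is_pullback C f g p q \<Longrightarrow> regular_epi C g \<Longrightarrow> regular_epi C p"
  using regular unfolding regular_category_def by blast

text \<open>The regular epi \<open>e\<close> is the coequalizer of the kernel pair of
  \<open>f\<close>. That the induced \<open>m\<close> is monic uses stability of regular epis under
  pullback.\<close>

lemma image_factorization:
  assumes f: "f \<in> Arr C"
  obtains m e where "regular_epi C e" "monic C m" "Dom C m = Cod C e" "m \<cdot> e = f"
proof -
  obtain p q where k: "is_pullback C f f p q" using pullback_exists[OF f f] by auto
  note d = is_pullbackD[OF k]
  obtain e where c: "is_coequalizer C p q e"
    using regular k unfolding regular_category_def by blast
  note ce = is_coequalizerD[OF c]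
  have re: "regular_epi C e" using c unfolding regular_epi_def by auto
  obtain m where m: "m \<in> Arr C" "Dom C m = Cod C e" "Cod C m = Cod C f" "m \<cdot> e = f"
    by (rule coequalizer_factor[OF c, of f]) (use d in auto)
  have de: "Dom C e = Dom C f" using ce d by simp
  have "monic C m"
  proof (rule monicI[OF m(1)])
    fix u v assume uv: "u \<in> Arr C" "v \<in> Arr C" "Dom C u = Dom C v" "Cod C u = Dom C m"
      "Cod C v = Dom C m" "m \<cdot> u = m \<cdot> v"
    \<comment> \<open>Two successive pullbacks of \<open>e\<close> cover the domain of
      \<open>u\<close> and \<open>v\<close> by regular epis \<open>e1\<close> and \<open>e2\<close>,
      after which both arrows lift through \<open>e\<close>, namely to \<open>a \<cdot> e2\<close>
      and \<open>b\<close>. The two lifts agree under \<open>f\<close>, hence form an arrow into the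
      kernel pair and are identified by \<open>e\<close>.\<close>
    obtain e1 a where 1: "is_pullback C u e e1 a"
      using pullback_exists[of u e] uv ce m by auto
    note d1 = is_pullbackD[OF 1]
    obtain e2 b where 2: "is_pullback C (v \<cdot> e1) e e2 b"
      using pullback_exists[of "v \<cdot> e1" e] uv ce m d1 by auto
    note d2 = is_pullbackD[OF 2]
    have c2: "Cod C e2 = Dom C e1" using d2 uv d1 by simp
    have ea: "e \<cdot> (a \<cdot> e2) = u \<cdot> (e1 \<cdot> e2)"
      by (rule Comp_eq_right) (use d1 d2 c2 in auto)
    have eb: "e \<cdot> b = v \<cdot> (e1 \<cdot> e2)" using d1 d2 c2 uv by simp
    have "f \<cdot> (a \<cdot> e2) = m \<cdot> (e \<cdot> (a \<cdot> e2))"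
      by (rule Comp_eq_right1[OF m(4), symmetric]) (use m d1 d2 c2 ce in auto)
    also have "\<dots> = m \<cdot> (v \<cdot> (e1 \<cdot> e2))" unfolding ea
      by (rule Comp_eq_right) (use uv m d1 d2 c2 in auto)
    also have "\<dots> = f \<cdot> b" unfolding eb[symmetric]
      by (rule Comp_eq_right1[OF m(4)]) (use m d1 d2 c2 ce in auto)
    finally obtain w where w: "w \<in> Arr C" "Dom C w = Dom C (a \<cdot> e2)" "Cod C w = Dom C p"
        "p \<cdot> w = a \<cdot> e2" "q \<cdot> w = b"
      by (rule pullback_lift[OF k, rotated -2]) (use d1 d2 c2 ce de in auto)
    have "e \<cdot> (p \<cdot> w) = e \<cdot> (q \<cdot> w)"
      by (rule Comp_eq_right) (use ce w d in auto)
    then have "(u \<cdot> e1) \<cdot> e2 = (v \<cdot> e1) \<cdot> e2" using w ea eb uv d1 d2 c2 by simp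
    then have "u \<cdot> e1 = v \<cdot> e1"
      by (rule regular_epi_cancel[OF regular_epi_pullback[OF 2 re], rotated -1]) (use uv(1-5) d1(3,6,7) d2(3) c2 in auto)
    then show "u = v"
      by (rule regular_epi_cancel[OF regular_epi_pullback[OF 1 re], rotated -1]) (use uv(1-5) d1(3,7) in auto)
  qed
  with re m that show thesis by blast
qed

end

locale regular_protomodular = regular_cat +
  assumes protomodular: "protomodular C"
begin

text \<open>An arrow is monic when the diagonal \<open>\<Delta>\<close> of its kernel pair is
  invertible. Protomodularity is applied to the split epi \<open>r1\<close> with section
  \<open>\<Delta>\<close>, pulled back along \<open>q\<close>: since \<open>p\<close> is monic, the
  resulting \<open>s\<close> factors through \<open>\<Delta>\<close>, and so the monic
  \<open>\<Delta>\<close> is an isomorphism.\<close>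

lemma pullback_reflects_monic:
  assumes pb: "is_pullback C f g p q" and p: "monic C p"
  shows "monic C g"
proof -
  note d = is_pullbackD[OF pb]
  obtain r1 r2 where k: "is_pullback C g g r1 r2" using pullback_exists d by metis
  note e = is_pullbackD[OF k]
  have O: "Dom C g \<in> Obj C" using d Dom_Obj by simp
  obtain \<Delta> where D: "\<Delta> \<in> Arr C" "Dom C \<Delta> = Dom C g" "Cod C \<Delta> = Dom C r1"
      "r1 \<cdot> \<Delta> = Ident C (Dom C g)" "r2 \<cdot> \<Delta> = Ident C (Dom C g)"
    by (rule pullback_lift[OF k, of "Ident C (Dom C g)" "Ident C (Dom C g)"]) (use d O in auto)
  have "section_of C r1 \<Delta>" unfolding section_of_def using D e by (auto simp: hom_def)
  then obtain h s where hs: "is_pullback C q r1 h s" and j: "jointly_extremally_epi C s \<Delta>"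
    using protomodular d e unfolding protomodular_def by metis
  note b = is_pullbackD[OF hs]
  have "g \<cdot> (r2 \<cdot> s) = g \<cdot> (r1 \<cdot> s)"
    by (rule Comp_eq_right) (use e b in auto)
  also have "\<dots> = f \<cdot> (p \<cdot> h)"
    unfolding b(9)[symmetric] by (rule Comp_eq_right) (use e b d in auto)
  finally have "f \<cdot> (p \<cdot> h) = g \<cdot> (r2 \<cdot> s)" by simp
  then obtain w where w: "w \<in> Arr C" "Dom C w = Dom C (p \<cdot> h)" "Cod C w = Dom C p"
      "p \<cdot> w = p \<cdot> h" "q \<cdot> w = r2 \<cdot> s"
    by (rule pullback_lift[OF pb, rotated -2]) (use e b d in auto)
  \<comment> \<open>Cancelling \<open>p\<close> turns the second component of \<open>w\<close> into
    \<open>q \<cdot> h = r2 \<cdot> s\<close>, while \<open>q \<cdot> h = r1 \<cdot> s\<close> by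
    the choice of \<open>h\<close> and \<open>s\<close>.\<close>
  have "w = h" by (rule monicD[OF p]) (use w b d in auto)
  then have rs: "r2 \<cdot> s = r1 \<cdot> s" using w b by simp
  have t: "r1 \<cdot> s \<in> Arr C" "Dom C (r1 \<cdot> s) = Dom C s" "Cod C (r1 \<cdot> s) = Dom C g"
    using e(3,7) b(4,8) by simp_all
  have s1: "r1 \<cdot> (\<Delta> \<cdot> (r1 \<cdot> s)) = Ident C (Dom C g) \<cdot> (r1 \<cdot> s)"
    by (rule Comp_eq_right1[OF D(4)]) (use D(1-3) e(3) t in auto)
  have s2: "r2 \<cdot> (\<Delta> \<cdot> (r1 \<cdot> s)) = Ident C (Dom C g) \<cdot> (r1 \<cdot> s)"
    by (rule Comp_eq_right1[OF D(5)]) (use D(1-3) e(3,4,6) t in auto)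
  have s: "\<Delta> \<cdot> (r1 \<cdot> s) = s"
  proof (rule pullback_cancel[OF k])
    show "r1 \<cdot> (\<Delta> \<cdot> (r1 \<cdot> s)) = r1 \<cdot> s"
      unfolding s1 using t by simp
    show "r2 \<cdot> (\<Delta> \<cdot> (r1 \<cdot> s)) = r2 \<cdot> s"
      unfolding s2 rs using t by simp
  qed (use D(1-3) b(4,8) t in auto)
  have mD: "monic C \<Delta>" by (rule split_monic[of _ r1]) (use D e in auto)
  have "is_iso C \<Delta>"
  proof -
    have "\<exists>g'\<in>hom C (Dom C s) (Dom C \<Delta>). \<Delta> \<cdot> g' = s"
      using s D e b by (intro bexI[of _ "r1 \<cdot> s"]) (auto simp: hom_def)
    moreover have "\<exists>s'\<in>hom C (Dom C \<Delta>) (Dom C \<Delta>). \<Delta> \<cdot> s' = \<Delta>"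
      using D O by (intro bexI[of _ "Ident C (Dom C \<Delta>)"]) (auto simp: hom_def)
    moreover have "Cod C \<Delta> = Cod C s" using D b by simp
    ultimately show ?thesis using j mD unfolding jointly_extremally_epi_def by blast
  qed
  then obtain n where n: "n \<in> Arr C" "Dom C n = Cod C \<Delta>" "Cod C n = Dom C \<Delta>"
    "\<Delta> \<cdot> n = Ident C (Cod C \<Delta>)" by (rule is_isoE)
  \<comment> \<open>Both projections are retractions of the invertible \<open>\<Delta>\<close>, so
    they coincide.\<close>
  have "r1 \<cdot> (\<Delta> \<cdot> n) = r2 \<cdot> (\<Delta> \<cdot> n)" by (rule Comp_eq_right) (use D e n in auto)
  then have r: "r1 = r2" using n D e by simp
  show ?thesis
  proof (rule monicI)
    fix u v assume uv: "u \<in> Arr C" "v \<in> Arr C" "Dom C u = Dom C v" "Cod C u = Dom C g"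
      "Cod C v = Dom C g" "g \<cdot> u = g \<cdot> v"
    obtain w where "r1 \<cdot> w = u" "r2 \<cdot> w = v"
      by (rule pullback_lift[OF k, of u v]) (use uv in auto)
    then show "u = v" using r by simp
  qed (use d in auto)
qed

end

section \<open>Reflective subcategories\<close>

lemma full_sub_simps [simp]:
  "Obj (full_sub C S) = S" "Dom (full_sub C S) = Dom C" "Cod (full_sub C S) = Cod C"
  "Ident (full_sub C S) = Ident C" "Comp (full_sub C S) = Comp C"
  "f \<in> Arr (full_sub C S) \<longleftrightarrow> f \<in> Arr C \<and> Dom C f \<in> S \<and> Cod C f \<in> S"
  by (simp_all add: full_sub_def)

lemma hom_full_sub:
  "f \<in> hom (full_sub C S) A B \<longleftrightarrow> f \<in> hom C A B \<and> A \<in> S \<and> B \<in> S"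
  by (auto simp: hom_def)

lemma (in plain_category) category_full_sub: "S \<subseteq> Obj C \<Longrightarrow> category (full_sub C S)"
  by (rule category.intro)
    (simp_all add: hom_full_sub Ident_hom subset_iff del: Comp_assoc',
      (elim conjE, rule Comp_hom Comp_Ident Ident_Comp Comp_assoc; assumption)+)

section \<open>Slice categories\<close>

lemma hom_slice:
  "k \<in> hom (slice C A) f g \<longleftrightarrow> f \<in> Arr C \<and> Cod C f = A \<and> g \<in> Arr C \<and> Cod C g = A \<and>
    (\<exists>h. h \<in> Arr C \<and> Dom C h = Dom C f \<and> Cod C h = Dom C g \<and> k = (f, g, h) \<and> g \<cdot>\<^bsub>C\<^esub> h = f)"
  by (cases k) (auto simp: slice_def hom_def)

lemma slice_simps [simp]:
  "f \<in> Obj (slice C A) \<longleftrightarrow> f \<in> Arr C \<and> Cod C f = A"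
  "Dom (slice C A) (f, g, h) = f" "Cod (slice C A) (f, g, h) = g"
  "Ident (slice C A) f = (f, f, Ident C (Dom C f))"
  "Comp (slice C A) (f', g', h') (f, g, h) = (f, g', h' \<cdot>\<^bsub>C\<^esub> h)"
  by (simp_all add: slice_def)

lemma (in plain_category) category_slice: "category (slice C A)"
proof (rule category.intro)
  fix k assume "k \<in> Arr (slice C A)"
  then have "k \<in> hom (slice C A) (Dom (slice C A) k) (Cod (slice C A) k)" by (simp add: hom_def)
  then show "Dom (slice C A) k \<in> Obj (slice C A)" "Cod (slice C A) k \<in> Obj (slice C A)"
    unfolding hom_slice by simp_all
next
  fix f assume "f \<in> Obj (slice C A)"
  then show "Ident (slice C A) f \<in> hom (slice C A) f f"
    using Dom_Obj by (simp add: hom_slice)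
next
  fix f g k e l assume "k \<in> hom (slice C A) f g" and "l \<in> hom (slice C A) g e"
  then obtain h h' where k: "k = (f, g, h)" "l = (g, e, h')"
    and h: "f \<in> Arr C" "Cod C f = A" "e \<in> Arr C" "Cod C e = A" "h \<in> Arr C" "Dom C h = Dom C f"
      "Cod C h = Dom C g" "h' \<in> Arr C" "Dom C h' = Dom C g" "Cod C h' = Dom C e"
    and e: "g \<cdot> h = f" "e \<cdot> h' = g"
    unfolding hom_slice by blast
  have "e \<cdot> (h' \<cdot> h) = f" using Comp_eq_right1[OF e(2), of h] h e(1) by simp
  then show "Comp (slice C A) l k \<in> hom (slice C A) f e"
    unfolding hom_slice using h k by simp
next
  fix f g k assume "k \<in> hom (slice C A) f g"
  then obtain h where "k = (f, g, h)" "h \<in> Arr C" "Dom C h = Dom C f" "Cod C h = Dom C g"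
    unfolding hom_slice by blast
  then show "Comp (slice C A) k (Ident (slice C A) f) = k" "Comp (slice C A) (Ident (slice C A) g) k = k"
    by simp_all
next
  fix f1 f2 f3 f4 k1 k2 k3
  assume "k1 \<in> hom (slice C A) f1 f2" "k2 \<in> hom (slice C A) f2 f3" "k3 \<in> hom (slice C A) f3 f4"
  then obtain h1 h2 h3 where "k1 = (f1, f2, h1)" "k2 = (f2, f3, h2)" "k3 = (f3, f4, h3)"
    "h1 \<in> Arr C" "Cod C h1 = Dom C f2" "h2 \<in> Arr C" "Dom C h2 = Dom C f2"
    "Cod C h2 = Dom C f3" "h3 \<in> Arr C" "Dom C h3 = Dom C f3"
    unfolding hom_slice by blast
  then show "Comp (slice C A) (Comp (slice C A) k3 k2) k1 = Comp (slice C A) k3 (Comp (slice C A) k2 k1)"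
    by simp
qed

lemma Obj_slice_on [simp]: "Obj (slice_on C \<A> A) = {f \<in> \<A>. f \<in> Arr C \<and> Cod C f = A}"
  by (simp add: slice_on_def)

lemma hom_slice_on:
  "k \<in> hom (slice_on C \<A> A) f g \<longleftrightarrow> f \<in> Obj (slice_on C \<A> A) \<and> g \<in> Obj (slice_on C \<A> A) \<and>
    (\<exists>h. h \<in> Arr C \<and> Dom C h = Dom C f \<and> Cod C h = Dom C g \<and> k = (f, g, h) \<and> g \<cdot>\<^bsub>C\<^esub> h = f)"
  by (auto simp: slice_on_def hom_full_sub hom_slice)

lemma hom_slice_on_full_sub:
  "k \<in> hom (slice_on (full_sub C S) (Arr (full_sub C S)) A) f g \<longleftrightarrow>
    f \<in> Obj (slice_on (full_sub C S) (Arr (full_sub C S)) A) \<and>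
    g \<in> Obj (slice_on (full_sub C S) (Arr (full_sub C S)) A) \<and>
    (\<exists>h. h \<in> Arr C \<and> Dom C h = Dom C f \<and> Cod C h = Dom C g \<and> k = (f, g, h) \<and> g \<cdot>\<^bsub>C\<^esub> h = f)"
  by (auto simp: hom_slice_on)

lemma slice_on_simps [simp]:
  "Ident (slice_on C \<A> A) f = (f, f, Ident C (Dom C f))"
  "Comp (slice_on C \<A> A) (f', g', h') (f, g, h) = (f, g', h' \<cdot>\<^bsub>C\<^esub> h)"
  by (simp_all add: slice_on_def)

lemma (in plain_category) category_slice_on: "category (slice_on C \<A> A)"
proof -
  interpret s: plain_category "slice C A"
    using category_slice by (simp add: plain_category_def)
  show ?thesis unfolding slice_on_def
    by (rule s.category_full_sub) (auto simp: slice_def)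
qed

section \<open>Reflections and their closure properties\<close>

locale reflective = plain_category C for C :: "('o, 'a) cat" (structure) +
  fixes S :: "'o set" and F :: "('o, 'a, 'o, 'a) cfunctor" and \<eta> \<epsilon> :: "'o \<Rightarrow> 'a"
  assumes S_replete: "replete C S"
    and adj: "adjunction C (full_sub C S) F inclusion \<eta> \<epsilon>"
begin

lemma S_Obj: "A \<in> S \<Longrightarrow> A \<in> Obj C"
  using S_replete by (auto simp: replete_def)

lemma reflector:
  shows F_functor: "is_functor C (full_sub C S) F"
    and F_S [simp]: "A \<in> Obj C \<Longrightarrow> fobj F A \<in> S"
    and F_Obj [simp]: "A \<in> Obj C \<Longrightarrow> fobj F A \<in> Obj C"
    and farr_F: "f \<in> Arr C \<Longrightarrow> farr F f \<in> hom C (fobj F (Dom C f)) (fobj F (Cod C f))"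
  using adj S_Obj unfolding adjunction_def is_functor_def by (auto simp: hom_full_sub)

lemma unit [simp]:
  assumes "A \<in> Obj C"
  shows "\<eta> A \<in> Arr C" "Dom C (\<eta> A) = A" "Cod C (\<eta> A) = fobj F A"
  using adj assms unfolding adjunction_def by (auto simp: inclusion_def hom_def)

lemma counit:
  assumes "B \<in> S"
  shows "\<epsilon> B \<in> Arr C" "Dom C (\<epsilon> B) = fobj F B" "Cod C (\<epsilon> B) = B"
  using adj assms unfolding adjunction_def by (auto simp: inclusion_def hom_full_sub hom_def)

text \<open>The adjunction is given by unit, counit and triangle identities; the universal
  factorization is recovered as the transpose, \<open>F f\<close> followed by the counit.\<close>

lemma reflect:
  assumes "f \<in> Arr C" "Cod C f \<in> S"
  obtains h where "h \<in> Arr C" "Dom C h = fobj F (Dom C f)" "Cod C h = Cod C f" "h \<cdot> \<eta> (Dom C f) = f"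
proof
  note d = Dom_Obj[OF assms(1)] Cod_Obj[OF assms(1)] and c = counit[OF assms(2)]
  have F: "farr F f \<in> Arr C" "Dom C (farr F f) = fobj F (Dom C f)" "Cod C (farr F f) = fobj F (Cod C f)"
    using farr_F[OF assms(1)] by (auto simp: hom_def)
  let ?h = "\<epsilon> (Cod C f) \<cdot> farr F f"
  show "?h \<in> Arr C" "Dom C ?h = fobj F (Dom C f)" "Cod C ?h = Cod C f" using F c by auto
  have n: "farr F f \<cdot> \<eta> (Dom C f) = \<eta> (Cod C f) \<cdot> f"
    using adj assms unfolding adjunction_def by (simp add: inclusion_def)
  have t: "\<epsilon> (Cod C f) \<cdot> \<eta> (Cod C f) = Ident C (Cod C f)"
    using adj assms unfolding adjunction_def by (simp add: inclusion_def)
  have "?h \<cdot> \<eta> (Dom C f) = \<epsilon> (Cod C f) \<cdot> (\<eta> (Cod C f) \<cdot> f)" using F c d n by simp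
  also have "\<dots> = Ident C (Cod C f) \<cdot> f" by (rule Comp_eq_right1[OF t]) (use c d assms in auto)
  finally show "?h \<cdot> \<eta> (Dom C f) = f" using assms by simp
qed

text \<open>An arrow \<open>k\<close> out of \<open>fobj F A\<close> is the transpose of
  \<open>k \<cdot> \<eta> A\<close>, by naturality of the counit and a triangle identity. It is
  therefore determined by that composite.\<close>

lemma reflect_unique:
  assumes A: "A \<in> Obj C" and S: "Cod C h \<in> S"
    and h: "h \<in> Arr C" "Dom C h = fobj F A" "h' \<in> Arr C" "Dom C h' = fobj F A" "Cod C h = Cod C h'"
    and e: "h \<cdot> \<eta> A = h' \<cdot> \<eta> A"
  shows "h = h'"
proof -
  have *: "\<epsilon> (Cod C k) \<cdot> farr F (k \<cdot> \<eta> A) = k"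
    if k: "k \<in> Arr C" "Dom C k = fobj F A" "Cod C k \<in> S" for k
  proof -
    have s: "fobj F A \<in> S" "fobj F A \<in> Obj C" using A by auto
    note c = counit[OF k(3)] counit[OF s(1)]
    have F: "farr F k \<in> Arr C" "Dom C (farr F k) = fobj F (fobj F A)" "Cod C (farr F k) = fobj F (Cod C k)"
      "farr F (\<eta> A) \<in> Arr C" "Dom C (farr F (\<eta> A)) = fobj F A" "Cod C (farr F (\<eta> A)) = fobj F (fobj F A)"
      using farr_F[OF k(1)] farr_F[of "\<eta> A"] A k by (auto simp: hom_def)
    have "farr F (k \<cdot> \<eta> A) = farr F k \<cdot> farr F (\<eta> A)"
      using F_functor A k unfolding is_functor_def by simp
    moreover have "\<epsilon> (Cod C k) \<cdot> farr F k = k \<cdot> \<epsilon> (fobj F A)"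
      using adj k s unfolding adjunction_def by (simp add: inclusion_def)
    moreover have t: "\<epsilon> (fobj F A) \<cdot> farr F (\<eta> A) = Ident C (fobj F A)"
      using adj A unfolding adjunction_def by simp
    ultimately show ?thesis
      using Comp_eq_right[of "\<epsilon> (Cod C k)" "farr F k" k "\<epsilon> (fobj F A)" "farr F (\<eta> A)"] F c k s
      by simp
  qed
  show ?thesis using *[OF h(1,2) S] *[OF h(3,4)] S e h(5) by metis
qed

text \<open>A retraction \<open>r\<close> of the unit is automatically an inverse, since
  \<open>\<eta> A \<cdot> r\<close> and the identity agree after precomposition with
  \<open>\<eta> A\<close>. Repleteness then puts \<open>A\<close> in \<open>S\<close>.\<close>

lemma split_unit_in_S:
  assumes A: "A \<in> Obj C" and r: "r \<in> Arr C" "Dom C r = fobj F A" "Cod C r = A"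
    "r \<cdot> \<eta> A = Ident C A"
  shows "A \<in> S"
proof -
  have "\<eta> A \<cdot> (r \<cdot> \<eta> A) = Ident C (fobj F A) \<cdot> \<eta> A" using A r(4) by simp
  then have "(\<eta> A \<cdot> r) \<cdot> \<eta> A = Ident C (fobj F A) \<cdot> \<eta> A" using A r(1-3) by simp
  then have "\<eta> A \<cdot> r = Ident C (fobj F A)"
    by (rule reflect_unique[OF A, rotated -1]) (use A r(1-3) in auto)
  then have "is_iso C r" using r A by (intro is_isoI[of r "\<eta> A"]) auto
  then have "isomorphic C (fobj F A) A" unfolding isomorphic_def using r(1-3) by (auto simp: hom_def)
  then show ?thesis using S_replete F_S[OF A] A unfolding replete_def by blast
qed

text \<open>Both projections extend along the unit of the pullback object, the extensions again form
  a cone, and the lift of this cone is a retraction of the unit.\<close>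

lemma pullback_closed:
  assumes pb: "is_pullback C f g p q" and S: "Dom C f \<in> S" "Dom C g \<in> S" "Cod C f \<in> S"
  shows "Dom C p \<in> S"
proof -
  note d = is_pullbackD[OF pb]
  let ?P = "Dom C p"
  have P: "?P \<in> Obj C" using d Dom_Obj by simp
  obtain p' where p': "p' \<in> Arr C" "Dom C p' = fobj F ?P" "Cod C p' = Cod C p" "p' \<cdot> \<eta> ?P = p"
    using reflect[of p] d(3,7) S by metis
  obtain q' where q': "q' \<in> Arr C" "Dom C q' = fobj F ?P" "Cod C q' = Cod C q" "q' \<cdot> \<eta> ?P = q"
    using reflect[of q] d(4,6,8) S by metis
  have dp: "Dom C f = Cod C p'" "Dom C g = Cod C q'" using p' q' d by auto
  have "(f \<cdot> p') \<cdot> \<eta> ?P = (g \<cdot> q') \<cdot> \<eta> ?P"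
    using p' q' P dp d(1,2,9) by simp
  then have "f \<cdot> p' = g \<cdot> q'"
    by (rule reflect_unique[OF P, rotated -1]) (use p'(1-3) q'(1-3) d(1-5) S dp in auto)
  then obtain r where r: "r \<in> Arr C" "Dom C r = Dom C p'" "Cod C r = ?P" "p \<cdot> r = p'" "q \<cdot> r = q'"
    by (rule pullback_lift[OF pb, rotated -2]) (use p'(1-3) q'(1-3) dp in auto)
  have "p \<cdot> (r \<cdot> \<eta> ?P) = p' \<cdot> \<eta> ?P"
    by (rule Comp_eq_right1[OF r(4)]) (use r(1-3) d(3) P p' in auto)
  then have "p \<cdot> (r \<cdot> \<eta> ?P) = p \<cdot> Ident C ?P" using p'(4) d(3) by simp
  moreover have "q \<cdot> (r \<cdot> \<eta> ?P) = q' \<cdot> \<eta> ?P"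
    by (rule Comp_eq_right1[OF r(5)]) (use r(1-3) d(4,6) P p' in auto)
  then have "q \<cdot> (r \<cdot> \<eta> ?P) = q \<cdot> Ident C ?P" using q'(4) d(4,6) by simp
  ultimately have "r \<cdot> \<eta> ?P = Ident C ?P"
    by (rule pullback_cancel[OF pb, rotated -2]) (use r(1-3) p'(1-3) P in auto)
  then show ?thesis
    by (rule split_unit_in_S[OF P, rotated -1]) (use r(1-3) p' in auto)
qed

lemma is_pullback_full_sub:
  assumes "is_pullback C f g p q" "Dom C f \<in> S" "Dom C g \<in> S" "Cod C f \<in> S"
  shows "is_pullback (full_sub C S) f g p q"
  using is_pullbackD[OF assms(1)] pullback_closed[OF assms] assms(2-)
  using assms(1) unfolding is_pullback_def[of "full_sub C S"]
  by (simp add: hom_full_sub) (simp add: is_pullback_def Ball_def hom_full_sub)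

lemma has_pullbacks_full_sub:
  assumes "has_pullbacks C"
  shows "has_pullbacks (full_sub C S)"
  unfolding has_pullbacks_def
proof (intro ballI impI)
  fix f g assume "f \<in> Arr (full_sub C S)" "g \<in> Arr (full_sub C S)"
    "Cod (full_sub C S) f = Cod (full_sub C S) g"
  then have fg: "f \<in> Arr C" "g \<in> Arr C" "Dom C f \<in> S" "Dom C g \<in> S" "Cod C f \<in> S" "Cod C f = Cod C g"
    by auto
  then obtain p q where "is_pullback C f g p q" using assms unfolding has_pullbacks_def by blast
  then show "\<exists>p q. is_pullback (full_sub C S) f g p q"
    using is_pullback_full_sub fg by blast
qed

end

section \<open>Relative admissibility and the functors between slices\<close>

lemma admissible_class_Arr: "category C \<Longrightarrow> admissible_class C (Arr C)"
  unfolding admissible_class_def is_iso_def is_pullback_def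
  using category.Comp_hom[of C] by (fastforce simp: hom_def)

context reflective
begin

lemma relatively_admissible:
  assumes "has_pullbacks C"
  shows "relatively_admissible_adjunction C (full_sub C S) F inclusion \<eta> \<epsilon> (Arr C) (Arr (full_sub C S))"
proof -
  have "category (full_sub C S)" by (rule category_full_sub) (use S_Obj in auto)
  moreover have "category C" by unfold_locales
  moreover have "farr F f \<in> Arr (full_sub C S)" if "f \<in> Arr C" for f
    using F_functor that unfolding is_functor_def by (auto simp: hom_def)
  moreover have "\<epsilon> B \<in> Arr (full_sub C S)" if "B \<in> S" for B
    using counit[OF that] that S_Obj by simp
  ultimately show ?thesis
    unfolding relatively_admissible_adjunction_def
    using adj assms has_pullbacks_full_sub admissible_class_Arr
    by (auto simp: inclusion_def image_subset_iff simp del: full_sub_simps(6))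
      (simp add: full_sub_simps(6))
qed

text \<open>The two hypotheses state that each pullback \<open>q\<close> of \<open>\<eta> X\<close>
  along an arrow \<open>g\<close> from \<open>S\<close> has the universal property of a reflection
  of its domain. Existence of extensions along \<open>q\<close> produces preimages of slice
  morphisms; uniqueness places them over \<open>fobj F X\<close> and gives faithfulness.\<close>

lemma slice_right_adjoint_full_faithful:
  assumes pb: "has_pullbacks C" and X: "X \<in> Obj C"
    and universal_ex: "\<And>g p q v. \<lbrakk>is_pullback C (\<eta> X) g p q; Dom C g \<in> S;
      v \<in> Arr C; Dom C v = Dom C q; Cod C v \<in> S\<rbrakk> \<Longrightarrow>
      \<exists>h. h \<in> Arr C \<and> Dom C h = Dom C g \<and> Cod C h = Cod C v \<and> h \<cdot> q = v"
    and universal_unique: "\<And>g p q h h'. \<lbrakk>is_pullback C (\<eta> X) g p q; Dom C g \<in> S;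
      h \<in> Arr C; h' \<in> Arr C; Dom C h = Dom C g; Dom C h' = Dom C g; Cod C h = Cod C h';
      Cod C h \<in> S; h \<cdot> q = h' \<cdot> q\<rbrakk> \<Longrightarrow> h = h'"
  defines "P \<equiv> slice_on (full_sub C S) (Arr (full_sub C S)) (fobj F X)"
    and "A \<equiv> slice_on C (Arr C) X"
    and "H \<equiv> slice_right_adjoint C inclusion \<eta> X"
  shows "full_functor P A H" and "faithful_functor P A H"
proof -
  define pr where "pr g = fst (chosen_pullback C (\<eta> X) g)" for g
  define qr where "qr g = snd (chosen_pullback C (\<eta> X) g)" for g
  have ObjP: "g \<in> Obj P \<longleftrightarrow> g \<in> Arr C \<and> Dom C g \<in> S \<and> Cod C g = fobj F X" for g
    using X unfolding P_def by auto
  have ObjA: "f \<in> Obj A \<longleftrightarrow> f \<in> Arr C \<and> Cod C f = X" for f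
    unfolding A_def by simp
  have homP: "k \<in> hom P f g \<longleftrightarrow> f \<in> Obj P \<and> g \<in> Obj P \<and>
      (\<exists>h. h \<in> Arr C \<and> Dom C h = Dom C f \<and> Cod C h = Dom C g \<and> k = (f, g, h) \<and> g \<cdot> h = f)" for k f g
    unfolding P_def by (rule hom_slice_on_full_sub)
  have homP': "(f, g, h) \<in> hom P f g \<longleftrightarrow> f \<in> Obj P \<and> g \<in> Obj P \<and>
      h \<in> Arr C \<and> Dom C h = Dom C f \<and> Cod C h = Dom C g \<and> g \<cdot> h = f" for f g h
    unfolding homP by simp
  have homA: "k \<in> hom A f g \<longleftrightarrow> f \<in> Obj A \<and> g \<in> Obj A \<and>
      (\<exists>h. h \<in> Arr C \<and> Dom C h = Dom C f \<and> Cod C h = Dom C g \<and> k = (f, g, h) \<and> g \<cdot> h = f)" for k f g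
    unfolding A_def by (rule hom_slice_on)
  have chosen: "is_pullback C (\<eta> X) g (pr g) (qr g)" if "g \<in> Obj P" for g
  proof -
    have "\<exists>z. case z of (p, q) \<Rightarrow> is_pullback C (\<eta> X) g p q"
      using pb that X unfolding has_pullbacks_def ObjP by simp
    then have "case chosen_pullback C (\<eta> X) g of (p, q) \<Rightarrow> is_pullback C (\<eta> X) g p q"
      unfolding chosen_pullback_def by (rule someI_ex)
    then show ?thesis by (simp add: pr_def qr_def case_prod_beta)
  qed
  have Hobj: "fobj H g = pr g" for g
    by (simp add: H_def slice_right_adjoint_def inclusion_def pr_def)
  define lift where "lift g g' h = (THE w. w \<in> hom C (Dom C (pr g)) (Dom C (pr g')) \<and>
    pr g' \<cdot> w = pr g \<and> qr g' \<cdot> w = h \<cdot> qr g)" for g g' h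
  have Harr: "farr H (g, g', h) = (pr g, pr g', lift g g' h)" for g g' h
    by (simp add: H_def slice_right_adjoint_def inclusion_def pr_def qr_def lift_def case_prod_beta)
  have prd: "pr g \<in> Arr C" "qr g \<in> Arr C" "Dom C (qr g) = Dom C (pr g)" "Cod C (pr g) = X"
      "Cod C (qr g) = Dom C g" "\<eta> X \<cdot> pr g = g \<cdot> qr g" if "g \<in> Obj P" for g
    using is_pullbackD[OF chosen[OF that]] X by auto
  \<comment> \<open>By joint monicity of the projections the definite description in
    \<open>lift\<close> is met by any arrow with the right two composites, so functoriality and
    fullness reduce to comparing composites.\<close>
  have lift_eqI: "lift g g' h = w" if g: "g \<in> Obj P" "g' \<in> Obj P" and w: "w \<in> Arr C"
      "Dom C w = Dom C (pr g)" "Cod C w = Dom C (pr g')" "pr g' \<cdot> w = pr g" "qr g' \<cdot> w = h \<cdot> qr g"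
    for g g' h w
    unfolding lift_def
  proof (rule the_equality)
    show "w \<in> hom C (Dom C (pr g)) (Dom C (pr g')) \<and> pr g' \<cdot> w = pr g \<and> qr g' \<cdot> w = h \<cdot> qr g"
      using w by (simp add: hom_def)
  next
    fix w' assume "w' \<in> hom C (Dom C (pr g)) (Dom C (pr g')) \<and> pr g' \<cdot> w' = pr g \<and> qr g' \<cdot> w' = h \<cdot> qr g"
    then have "w' \<in> Arr C" "Dom C w' = Dom C w" "Cod C w' = Dom C (pr g')"
      and e: "pr g' \<cdot> w' = pr g' \<cdot> w" "qr g' \<cdot> w' = qr g' \<cdot> w"
      using w by (simp_all add: hom_def)
    then show "w' = w" by (intro pullback_cancel[OF chosen[OF g(2)] _ _ _ _ _ e]) (use w in auto)
  qed
  have lift: "lift g g' h \<in> Arr C \<and> Dom C (lift g g' h) = Dom C (pr g) \<and>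
      Cod C (lift g g' h) = Dom C (pr g') \<and> pr g' \<cdot> lift g g' h = pr g \<and>
      qr g' \<cdot> lift g g' h = h \<cdot> qr g"
    if k: "(g, g', h) \<in> hom P g g'" for g g' h
  proof -
    have h: "h \<in> Arr C" "Dom C h = Dom C g" "Cod C h = Dom C g'" "g' \<cdot> h = g"
      and g: "g \<in> Obj P" "g' \<in> Obj P" using k unfolding homP' by blast+
    have "g' \<cdot> (h \<cdot> qr g) = g \<cdot> qr g"
      by (rule Comp_eq_right1[OF h(4)]) (use h g prd ObjP in auto)
    then have "\<eta> X \<cdot> pr g = g' \<cdot> (h \<cdot> qr g)" using prd(6)[OF g(1)] by simp
    then obtain w where w: "w \<in> Arr C" "Dom C w = Dom C (pr g)" "Cod C w = Dom C (pr g')"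
        "pr g' \<cdot> w = pr g" "qr g' \<cdot> w = h \<cdot> qr g"
      by (rule pullback_lift[OF chosen[OF g(2)], rotated -2]) (use h g prd X in auto)
    then show ?thesis using lift_eqI[OF g w] by simp
  qed
  have cat: "category P" "category A"
  proof -
    interpret s: plain_category "full_sub C S"
      unfolding plain_category_def by (rule category_full_sub) (use S_Obj in auto)
    show "category P" unfolding P_def by (rule s.category_slice_on)
    show "category A" unfolding A_def by (rule category_slice_on)
  qed
  have Hhom: "farr H k \<in> hom A (pr g) (pr g')" if hk: "k \<in> hom P g g'" for k g g'
  proof -
    obtain h where k: "k = (g, g', h)" and g: "g \<in> Obj P" "g' \<in> Obj P" using hk unfolding homP by blast
    show ?thesis using lift[of g g' h] hk prd[OF g(1)] prd[OF g(2)]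
      unfolding k Harr homA ObjA by auto
  qed
  have ArrP: "k \<in> hom P (Dom P k) (Cod P k)" if "k \<in> Arr P" for k using that by (simp add: hom_def)
  have HF: "is_functor P A H"
    unfolding is_functor_def Hobj
  proof (intro conjI ballI impI)
    fix g assume g: "g \<in> Obj P"
    show "pr g \<in> Obj A" using prd[OF g] by (simp add: ObjA)
    have "lift g g (Ident C (Dom C g)) = Ident C (Dom C (pr g))"
      by (rule lift_eqI[OF g g]) (use prd[OF g] Dom_Obj in auto)
    then show "farr H (Ident P g) = Ident A (pr g)" by (simp add: P_def A_def Harr)
  next
    fix k assume "k \<in> Arr P"
    then show "farr H k \<in> hom A (pr (Dom P k)) (pr (Cod P k))" by (intro Hhom ArrP)
  next
    fix k l assume kl: "k \<in> Arr P" "l \<in> Arr P" "Dom P l = Cod P k"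
    obtain f g h where k: "k = (f, g, h)" and kh: "(f, g, h) \<in> hom P f g"
      using ArrP[OF kl(1)] unfolding homP' unfolding homP by blast
    have "Dom P l = g" using kh kl(3) k by (simp add: hom_def)
    then obtain e h' where l: "l = (g, e, h')" and lh: "(g, e, h') \<in> hom P g e"
      using ArrP[OF kl(2)] unfolding homP' unfolding homP by blast
    have o: "f \<in> Obj P" "g \<in> Obj P" "e \<in> Obj P" and
      h: "h \<in> Arr C" "Dom C h = Dom C f" "Cod C h = Dom C g"
        "h' \<in> Arr C" "Dom C h' = Dom C g" "Cod C h' = Dom C e"
      using kh lh unfolding homP' by blast+
    note p = prd[OF o(1)] prd[OF o(2)] prd[OF o(3)]
    note L = lift[OF kh] lift[OF lh]
    let ?u = "lift f g h" and ?v = "lift g e h'"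
    have "lift f e (h' \<cdot> h) = ?v \<cdot> ?u"
    proof (rule lift_eqI[OF o(1,3)])
      have "pr e \<cdot> (?v \<cdot> ?u) = pr g \<cdot> ?u"
        by (rule Comp_eq_right1) (use L p(13-16) in auto)
      then show "pr e \<cdot> (?v \<cdot> ?u) = pr f" using L by simp
      have "qr e \<cdot> (?v \<cdot> ?u) = h' \<cdot> (qr g \<cdot> ?u)"
        by (rule Comp_eq_right) (use L p h in auto)
      then show "qr e \<cdot> (?v \<cdot> ?u) = (h' \<cdot> h) \<cdot> qr f" using L h p(1-5) by simp
    qed (use L in auto)
    then show "farr H (Comp P l k) = Comp A (farr H l) (farr H k)"
      unfolding k l by (simp add: P_def A_def Harr)
  qed (use cat in auto)
  show "full_functor P A H"
    unfolding full_functor_def Hobj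
  proof (intro conjI ballI HF)
    fix g g' k assume g: "g \<in> Obj P" "g' \<in> Obj P" and "k \<in> hom A (pr g) (pr g')"
    then obtain w where k: "k = (pr g, pr g', w)" and w: "w \<in> Arr C" "Dom C w = Dom C (pr g)"
      "Cod C w = Dom C (pr g')" "pr g' \<cdot> w = pr g" unfolding homA by blast
    note p = prd[OF g(1)] prd[OF g(2)]
    note gg = g[unfolded ObjP]
    \<comment> \<open>The preimage of \<open>w\<close> is the extension along \<open>qr g\<close> of
      \<open>qr g' \<cdot> w\<close>, whose codomain lies in \<open>S\<close>.\<close>
    obtain h where h: "h \<in> Arr C" "Dom C h = Dom C g" "Cod C h = Dom C g'" "h \<cdot> qr g = qr g' \<cdot> w"
      using universal_ex[OF chosen[OF g(1)], of "qr g' \<cdot> w"] w p gg by auto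
    \<comment> \<open>That \<open>h\<close> is an arrow over \<open>fobj F X\<close> is checked
      after precomposition with \<open>qr g\<close>, where both sides reduce to
      \<open>\<eta> X \<cdot> pr g\<close>.\<close>
    have "g' \<cdot> (qr g' \<cdot> w) = \<eta> X \<cdot> (pr g' \<cdot> w)"
      by (rule Comp_eq_right) (use p(6-) w(1-3) gg X in auto)
    then have "(g' \<cdot> h) \<cdot> qr g = g \<cdot> qr g" using h p(1-6) gg w(4) by simp
    then have "g' \<cdot> h = g"
      by (rule universal_unique[OF chosen[OF g(1)], rotated -1]) (use h(1-3) gg X in auto)
    then have "(g, g', h) \<in> hom P g g'" using g h unfolding homP' by blast
    moreover have "lift g g' h = w" by (rule lift_eqI[OF g w]) (simp add: h)
    ultimately show "\<exists>h\<in>hom P g g'. farr H h = k" using Harr k by auto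
  qed
  show "faithful_functor P A H"
    unfolding faithful_functor_def
  proof (intro conjI ballI HF inj_onI)
    fix g g' k k' assume g: "g \<in> Obj P" "g' \<in> Obj P" and kk: "k \<in> hom P g g'" "k' \<in> hom P g g'"
      and e: "farr H k = farr H k'"
    obtain h h' where k: "k = (g, g', h)" "k' = (g, g', h')" using kk unfolding homP by blast
    have h: "h \<in> Arr C" "Dom C h = Dom C g" "Cod C h = Dom C g'"
      "h' \<in> Arr C" "Dom C h' = Dom C g" "Cod C h' = Dom C g'" using kk unfolding k homP' by blast+
    have "h \<cdot> qr g = h' \<cdot> qr g" using lift[of g g' h] lift[of g g' h'] kk k e by (simp add: Harr)
    then have "h = h'"
      by (rule universal_unique[OF chosen[OF g(1)], rotated -1]) (use h g ObjP in auto)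
    then show "k = k'" by (simp add: k)
  qed
qed

end

section \<open>Zero objects and torsion theories\<close>

locale zero_objects = plain_category C for C :: "('o, 'a) cat" (structure) +
  fixes Z :: "'o set" and Zf :: "('o, 'a, 'o, 'a) cfunctor" and \<zeta> :: "'o \<Rightarrow> 'a"
  assumes zero: "class_of_zero_objects C Z Zf \<zeta>"
begin

lemma Z_replete: "replete C Z"
  using zero by (simp add: class_of_zero_objects_def)

lemma Z_posetal:
  "\<lbrakk>f \<in> Arr C; g \<in> Arr C; Dom C f = Dom C g; Cod C f = Cod C g; Dom C f \<in> Z; Cod C f \<in> Z\<rbrakk> \<Longrightarrow> f = g"
  using zero unfolding class_of_zero_objects_def by (metis homI)

lemma coreflection_unit: obtains \<upsilon> where "adjunction (full_sub C Z) C inclusion Zf \<upsilon> \<zeta>"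
  using zero unfolding class_of_zero_objects_def by blast

lemma counit_zero:
  assumes "A \<in> Obj C"
  shows "\<zeta> A \<in> Arr C" "Dom C (\<zeta> A) = fobj Zf A" "Cod C (\<zeta> A) = A" "fobj Zf A \<in> Z" "monic C (\<zeta> A)"
proof -
  obtain \<upsilon> where a: "adjunction (full_sub C Z) C inclusion Zf \<upsilon> \<zeta>" by (rule coreflection_unit)
  then have "\<zeta> A \<in> hom C (fobj Zf A) A"
    using assms unfolding adjunction_def by (simp add: inclusion_def)
  then show "\<zeta> A \<in> Arr C" "Dom C (\<zeta> A) = fobj Zf A" "Cod C (\<zeta> A) = A" by (auto simp: hom_def)
  show "fobj Zf A \<in> Z" using a assms unfolding adjunction_def is_functor_def by simp
  show "monic C (\<zeta> A)" using zero assms unfolding class_of_zero_objects_def by blast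
qed

lemma farr_Zf:
  assumes "f \<in> Arr C"
  shows "farr Zf f \<in> Arr C" "Dom C (farr Zf f) = fobj Zf (Dom C f)" "Cod C (farr Zf f) = fobj Zf (Cod C f)"
    and counit_zero_natural: "\<zeta> (Cod C f) \<cdot> farr Zf f = f \<cdot> \<zeta> (Dom C f)"
proof -
  obtain \<upsilon> where a: "adjunction (full_sub C Z) C inclusion Zf \<upsilon> \<zeta>" by (rule coreflection_unit)
  then have "farr Zf f \<in> hom (full_sub C Z) (fobj Zf (Dom C f)) (fobj Zf (Cod C f))"
    using assms unfolding adjunction_def is_functor_def by simp
  then show "farr Zf f \<in> Arr C" "Dom C (farr Zf f) = fobj Zf (Dom C f)" "Cod C (farr Zf f) = fobj Zf (Cod C f)"
    by (auto simp: hom_def)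
  show "\<zeta> (Cod C f) \<cdot> farr Zf f = f \<cdot> \<zeta> (Dom C f)"
    using a assms unfolding adjunction_def by (simp add: inclusion_def)
qed

text \<open>The factorization is the transpose of \<open>f\<close>, the unit of the coreflection
  followed by the image of \<open>f\<close>. Its uniqueness would be immediate from
  \<open>\<zeta>\<close> being monic.\<close>

lemma coreflect:
  assumes f: "f \<in> Arr C" and Z: "Dom C f \<in> Z"
  obtains w where "w \<in> Arr C" "Dom C w = Dom C f" "Cod C w = fobj Zf (Cod C f)" "\<zeta> (Cod C f) \<cdot> w = f"
proof -
  obtain \<upsilon> where a: "adjunction (full_sub C Z) C inclusion Zf \<upsilon> \<zeta>" by (rule coreflection_unit)
  let ?W = "Dom C f"
  have "\<upsilon> ?W \<in> hom (full_sub C Z) ?W (fobj Zf ?W)"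
    using a Z unfolding adjunction_def by (simp add: inclusion_def)
  then have u: "\<upsilon> ?W \<in> Arr C" "Dom C (\<upsilon> ?W) = ?W" "Cod C (\<upsilon> ?W) = fobj Zf ?W"
    by (auto simp: hom_def)
  have t: "\<zeta> ?W \<cdot> \<upsilon> ?W = Ident C ?W"
    using a Z unfolding adjunction_def by (simp add: inclusion_def)
  note c = counit_zero[OF Dom_Obj[OF f]] counit_zero[OF Cod_Obj[OF f]] and F = farr_Zf[OF f]
  have "\<zeta> (Cod C f) \<cdot> (farr Zf f \<cdot> \<upsilon> ?W) = f \<cdot> (\<zeta> ?W \<cdot> \<upsilon> ?W)"
    by (rule Comp_eq_right[OF F(4)]) (use u c F(1-3) f in auto)
  then show thesis using t f u F(1-3) by (intro that[of "farr Zf f \<cdot> \<upsilon> ?W"]) simp_all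
qed

text \<open>The coreflector inverts \<open>m\<close>, so by naturality the counit at
  \<open>Cod C m\<close> is \<open>m\<close> after the counit at \<open>Dom C m\<close> after that
  inverse.\<close>

lemma counit_zero_factors_monic:
  assumes m: "monic C m"
  obtains i where "i \<in> Arr C" "Dom C i = fobj Zf (Cod C m)" "Cod C i = Dom C m" "m \<cdot> i = \<zeta> (Cod C m)"
proof -
  note f = monic_Arr[OF m]
  note c = counit_zero[OF Dom_Obj[OF f]] counit_zero[OF Cod_Obj[OF f]] and F = farr_Zf[OF f]
  have "is_iso (full_sub C Z) (farr Zf m)"
    using zero m unfolding class_of_zero_objects_def by blast
  then obtain n where n: "n \<in> Arr C" "Dom C n = fobj Zf (Cod C m)" "Cod C n = fobj Zf (Dom C m)"
      "farr Zf m \<cdot> n = Ident C (fobj Zf (Cod C m))"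
    using F(1-3) unfolding is_iso_def by (auto simp: hom_def)
  have "m \<cdot> (\<zeta> (Dom C m) \<cdot> n) = \<zeta> (Cod C m) \<cdot> (farr Zf m \<cdot> n)"
    by (rule Comp_eq_right[OF F(4)[symmetric]]) (use n(1-3) c F(1-3) f in auto)
  then show thesis using n c by (intro that[of "\<zeta> (Dom C m) \<cdot> n"]) simp_all
qed

lemma null_arrowsI:
  assumes "W \<in> Z" "u \<in> Arr C" "Cod C u = W" "v \<in> Arr C" "Dom C v = W"
  shows "v \<cdot> u \<in> null_arrows C Z"
proof -
  have "v \<cdot> u \<in> Arr C" "u \<in> hom C (Dom C (v \<cdot> u)) W" "v \<in> hom C W (Cod C (v \<cdot> u))"
    using assms by (simp_all add: hom_def)
  with assms(1) show ?thesis unfolding null_arrows_def by blast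
qed

text \<open>By the coreflection, the unspecified zero object in a null arrow can be replaced by the
  coreflection of the codomain.\<close>

lemma null_arrows_iff:
  assumes "f \<in> Arr C"
  shows "f \<in> null_arrows C Z \<longleftrightarrow> (\<exists>u. u \<in> Arr C \<and> Dom C u = Dom C f \<and>
    Cod C u = fobj Zf (Cod C f) \<and> \<zeta> (Cod C f) \<cdot> u = f)"
proof
  note c = counit_zero[OF Cod_Obj[OF assms]]
  assume "f \<in> null_arrows C Z"
  then obtain W u v where W: "W \<in> Z" and u: "u \<in> Arr C" "Dom C u = Dom C f" "Cod C u = W"
    and v: "v \<in> Arr C" "Dom C v = W" "Cod C v = Cod C f" and e: "f = v \<cdot> u"
    unfolding null_arrows_def hom_def by blast
  obtain w where w: "w \<in> Arr C" "Dom C w = W" "Cod C w = fobj Zf (Cod C f)" "\<zeta> (Cod C f) \<cdot> w = v"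
    using coreflect[of v] W v by metis
  have "\<zeta> (Cod C f) \<cdot> (w \<cdot> u) = v \<cdot> u"
    by (rule Comp_eq_right1[OF w(4)]) (use w(1-3) u c in auto)
  then show "\<exists>u. u \<in> Arr C \<and> Dom C u = Dom C f \<and> Cod C u = fobj Zf (Cod C f) \<and> \<zeta> (Cod C f) \<cdot> u = f"
    using e u w(1-3) by (intro exI[of _ "w \<cdot> u"]) simp
next
  assume "\<exists>u. u \<in> Arr C \<and> Dom C u = Dom C f \<and> Cod C u = fobj Zf (Cod C f) \<and> \<zeta> (Cod C f) \<cdot> u = f"
  then show "f \<in> null_arrows C Z"
    using null_arrowsI counit_zero[OF Cod_Obj[OF assms]] by metis
qed

end

text \<open>A single family \<open>\<eta>\<close> serves both as the unit of the reflection and as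
  the chosen \<open>Z\<close>-cokernels of \<open>t\<close>.\<close>

locale torsion_theory = regular_protomodular C + reflective C \<F> F \<eta> \<epsilon> + zero_objects C Z Zf \<zeta>
  for C :: "('o, 'a) cat" (structure) and \<F> F \<eta> \<epsilon> Z Zf \<zeta> +
  fixes \<T> :: "'o set" and t :: "'o \<Rightarrow> 'a"
  assumes torsion: "Z_torsion_theory C Z \<T> \<F> t \<eta>"
    and M': "condition_M' C Zf t F"
    and S: "condition_S C Z \<T> F \<eta>"
begin

lemma torsion_exact:
  assumes "A \<in> Obj C"
  shows "Z_kernel C Z (\<eta> A) (t A)" "Z_cokernel C Z (t A) (\<eta> A)" "Cod C (t A) = A" "Dom C (t A) \<in> \<T>"
    "t A \<in> Arr C" "\<eta> A \<cdot> t A \<in> null_arrows C Z"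
  using torsion assms unfolding Z_torsion_theory_def short_Z_exact_def Z_kernel_def by auto

text \<open>In the image factorization \<open>\<eta> A = m \<cdot> e\<close>, the counit at
  \<open>fobj F A\<close> factors through the monic \<open>m\<close>, so that already
  \<open>e \<cdot> t A\<close> is null. The cokernel property then factors \<open>e\<close> through
  \<open>\<eta> A\<close>, which yields an inverse of \<open>m\<close>.\<close>

lemma unit_regular_epi:
  assumes A: "A \<in> Obj C"
  shows "regular_epi C (\<eta> A)"
proof -
  note T = torsion_exact[OF A]
  obtain m e where me: "regular_epi C e" "monic C m" "Dom C m = Cod C e" "m \<cdot> e = \<eta> A"
    by (rule image_factorization[OF unit(1)[OF A]])
  note m = monic_Arr[OF me(2)] and e = regular_epi_Arr[OF me(1)]
  have "Cod C (m \<cdot> e) = fobj F A" "Dom C (m \<cdot> e) = A" unfolding me(4) using A by simp_all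
  then have d: "Cod C m = fobj F A" "Dom C e = A" using m e me(3) by auto
  obtain u where u: "u \<in> Arr C" "Dom C u = Dom C (t A)" "Cod C u = fobj Zf (fobj F A)"
      "\<zeta> (fobj F A) \<cdot> u = \<eta> A \<cdot> t A"
    using T(6) null_arrows_iff[of "\<eta> A \<cdot> t A"] T(3,5) A by auto
  obtain i where i: "i \<in> Arr C" "Dom C i = fobj Zf (fobj F A)" "Cod C i = Dom C m" "m \<cdot> i = \<zeta> (fobj F A)"
    using counit_zero_factors_monic[OF me(2)] d by metis
  have "m \<cdot> (e \<cdot> t A) = \<eta> A \<cdot> t A"
    by (rule Comp_eq_right1[OF me(4)]) (use m e me(3) d T(3,5) in auto)
  also have "\<dots> = m \<cdot> (i \<cdot> u)" unfolding u(4)[symmetric]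
    by (rule Comp_eq_right1[OF i(4), symmetric]) (use m i(1-3) u(1-3) in auto)
  finally have eq: "e \<cdot> t A = i \<cdot> u"
    by (rule monicD[OF me(2), rotated -1]) (use m e i(1-3) u(1-3) d T(3,5) me(3) in auto)
  have "i \<cdot> u \<in> null_arrows C Z"
    by (rule null_arrowsI) (use i(1,2) u(1,3) counit_zero(4)[of "fobj F A"] A in auto)
  then have n: "e \<cdot> t A \<in> null_arrows C Z" unfolding eq .
  have ex: "\<exists>!w. w \<in> hom C (fobj F A) E \<and> w \<cdot> \<eta> A = f"
    if "f \<in> hom C A E" "f \<cdot> t A \<in> null_arrows C Z" for f E
    using T(2) that T(3) A unfolding Z_cokernel_def by simp
  obtain w where w: "w \<in> Arr C" "Dom C w = fobj F A" "Cod C w = Cod C e" "w \<cdot> \<eta> A = e"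
    using ex[of e "Cod C e"] n e d by (auto simp: hom_def)
  have "m \<cdot> (w \<cdot> \<eta> A) = \<eta> A" unfolding w(4) me(4) ..
  then have 1: "m \<cdot> w \<in> hom C (fobj F A) (fobj F A) \<and> (m \<cdot> w) \<cdot> \<eta> A = \<eta> A"
    using w(1-3) m me(3) d A by (simp add: hom_def)
  have 2: "Ident C (fobj F A) \<in> hom C (fobj F A) (fobj F A) \<and> Ident C (fobj F A) \<cdot> \<eta> A = \<eta> A"
    using A by (simp add: hom_def)
  \<comment> \<open>The cokernel property for \<open>\<eta> A\<close> itself: its only factorization
    through \<open>\<eta> A\<close> is the identity, so \<open>m \<cdot> w\<close> must be the
    identity.\<close>
  have "\<exists>!w. w \<in> hom C (fobj F A) (fobj F A) \<and> w \<cdot> \<eta> A = \<eta> A"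
    by (rule ex) (use T(6) A in \<open>auto simp: hom_def\<close>)
  then have mw: "m \<cdot> w = Ident C (fobj F A)" using 1 2 by blast
  have "m \<cdot> (w \<cdot> m) = m \<cdot> Ident C (Dom C m)"
    using Comp_eq_right1[OF mw, of m] w(1-3) m me(3) d Dom_Obj[OF m] by simp
  then have "w \<cdot> m = Ident C (Dom C m)"
    by (rule monicD[OF me(2), rotated -1]) (use w(1-3) m me(3) d Dom_Obj[OF m] in auto)
  then have "is_iso C m" using mw w(1-3) m me(3) d by (intro is_isoI[of m w]) simp_all
  then show ?thesis using regular_epi_iso_Comp[OF me(1) _ me(3)] unfolding me(4) by blast
qed

text \<open>Since \<open>m\<close> factors through the unit at its domain, that unit is monic; being
  also a regular epi, it is invertible.\<close>

lemma torsion_free_subobject: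
  assumes m: "monic C m" and F: "Cod C m \<in> \<F>"
  shows "Dom C m \<in> \<F>"
proof -
  let ?N = "Dom C m"
  have N: "?N \<in> Obj C" using Dom_Obj monic_Arr[OF m] by simp
  obtain h where h: "h \<in> Arr C" "Dom C h = fobj F ?N" "h \<cdot> \<eta> ?N = m"
    using reflect[OF monic_Arr[OF m] F] by metis
  have "monic C (\<eta> ?N)"
    by (rule monic_of_Comp[of h]) (use h m N in auto)
  then have "is_iso C (\<eta> ?N)" using regular_epi_monic_iso unit_regular_epi[OF N] by blast
  then obtain r where "r \<in> Arr C" "Dom C r = fobj F ?N" "Cod C r = ?N" "r \<cdot> \<eta> ?N = Ident C ?N"
    by (rule is_isoE) (use N in auto)
  then show ?thesis by (rule split_unit_in_S[OF N])
qed

text \<open>This is the uniqueness half of the kernel property: anything factoring through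
  \<open>t A\<close> stays null under \<open>\<eta> A\<close>.\<close>

lemma torsion_monic:
  assumes A: "A \<in> Obj C"
  shows "monic C (t A)"
proof (rule monicI)
  note T = torsion_exact[OF A]
  show "t A \<in> Arr C" by (rule T)
  fix u v assume uv: "u \<in> Arr C" "v \<in> Arr C" "Dom C u = Dom C v" "Cod C u = Dom C (t A)"
    "Cod C v = Dom C (t A)" "t A \<cdot> u = t A \<cdot> v"
  obtain W x y where "W \<in> Z" and x: "x \<in> Arr C" "Dom C x = Dom C (t A)" "Cod C x = W"
    and y: "y \<in> Arr C" "Dom C y = W" "Cod C y = fobj F A" "y \<cdot> x = \<eta> A \<cdot> t A"
    using T(3,5,6) A unfolding null_arrows_def hom_def by auto
  have "\<eta> A \<cdot> (t A \<cdot> u) = y \<cdot> (x \<cdot> u)"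
    by (rule Comp_eq_right[OF y(4)[symmetric]]) (use uv x y(1-3) T(3,5) A in auto)
  moreover have "y \<cdot> (x \<cdot> u) \<in> null_arrows C Z"
    by (rule null_arrowsI[OF \<open>W \<in> Z\<close>]) (use uv(1,4) x y(1,2) in auto)
  ultimately have "\<eta> A \<cdot> (t A \<cdot> u) \<in> null_arrows C Z" by simp
  moreover have "t A \<cdot> u \<in> hom C (Dom C u) (Dom C (\<eta> A))"
    using T(3,5) uv(1,4) A by (simp add: hom_def)
  ultimately have "\<exists>!w. w \<in> hom C (Dom C u) (Dom C (t A)) \<and> t A \<cdot> w = t A \<cdot> u"
    using T(1) unfolding Z_kernel_def by blast
  then show "u = v" using uv unfolding hom_def by (metis (mono_tags, lifting) mem_Collect_eq)
qed

text \<open>The existence half of the kernel property, for a null composite given with its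
  factorization through a zero object.\<close>

lemma torsion_lift:
  assumes A: "A \<in> Obj C" and v: "v \<in> Arr C" "Cod C v = A" and W: "W \<in> Z"
    and x: "x \<in> Arr C" "Dom C x = Dom C v" "Cod C x = W" and y: "y \<in> Arr C" "Dom C y = W"
    and e: "\<eta> A \<cdot> v = y \<cdot> x"
  obtains w where "w \<in> Arr C" "Dom C w = Dom C v" "Cod C w = Dom C (t A)" "t A \<cdot> w = v"
proof -
  note T = torsion_exact[OF A]
  have "\<eta> A \<cdot> v \<in> null_arrows C Z"
    unfolding e by (rule null_arrowsI[OF W x(1,3) y])
  then have "\<exists>!w. w \<in> hom C (Dom C v) (Dom C (t A)) \<and> t A \<cdot> w = v"
    using T(1) v A unfolding Z_kernel_def by (simp add: hom_def)
  then show thesis using that by (auto simp: hom_def)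
qed

text \<open>Condition (M') identifies the comparison \<open>F (T A) \<rightarrow> F A\<close> with the counit \<open>Z (F A) \<rightarrow> F A\<close>.\<close>

lemma torsion_reflection_monic:
  assumes A: "A \<in> Obj C"
  obtains j where "monic C j" "Dom C j = fobj F (Dom C (t A))" "Cod C j = fobj F A"
    "j \<cdot> \<eta> (Dom C (t A)) = \<eta> A \<cdot> t A"
    "\<And>w. w \<in> Arr C \<Longrightarrow> Dom C w \<in> Z \<Longrightarrow> Cod C w = fobj F A \<Longrightarrow>
      \<exists>z. z \<in> Arr C \<and> Dom C z = Dom C w \<and> Cod C z = Dom C j \<and> j \<cdot> z = w"
proof -
  note T = torsion_exact[OF A]
  let ?T = "Dom C (t A)"
  have TO: "?T \<in> Obj C" using T(5) Dom_Obj by simp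
  have FO: "fobj F A \<in> Obj C" using A by simp
  note c = counit_zero[OF FO]
  obtain j where j: "j \<in> Arr C" "Dom C j = fobj F ?T" "Cod C j = fobj F A" "j \<cdot> \<eta> ?T = \<eta> A \<cdot> t A"
    using reflect[of "\<eta> A \<cdot> t A"] T(3,5) A by auto
  have "isomorphic C (fobj F ?T) (fobj Zf (fobj F A))"
    using M' A unfolding condition_M'_def by blast
  then obtain \<phi> where \<phi>: "is_iso C \<phi>" "\<phi> \<in> Arr C" "Dom C \<phi> = fobj F ?T" "Cod C \<phi> = fobj Zf (fobj F A)"
    unfolding isomorphic_def hom_def by blast
  have FT: "fobj F ?T \<in> Z"
    using isomorphic_sym[OF \<open>isomorphic C _ _\<close>] Z_replete c(4) TO unfolding replete_def by (meson F_Obj)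
  obtain k where k: "k \<in> Arr C" "Dom C k = fobj F ?T" "Cod C k = fobj Zf (fobj F A)" "\<zeta> (fobj F A) \<cdot> k = j"
    using coreflect[of j] j FT by metis
  \<comment> \<open>Condition (M') supplies only some isomorphism \<open>\<phi>\<close>, unrelated
    to the comparison \<open>j\<close>. Both \<open>k\<close> and \<open>\<phi>\<close> run between
    the same zero objects, so posetality identifies them and makes \<open>k\<close>
    invertible.\<close>
  have k\<phi>: "k = \<phi>" by (rule Z_posetal) (use k \<phi> FT c in auto)
  have "monic C (\<zeta> (fobj F A) \<cdot> k)"
    by (rule monic_Comp) (use k \<phi> k\<phi> c iso_monic in auto)
  then have mj: "monic C j" unfolding k(4) .
  obtain n where n: "n \<in> Arr C" "Dom C n = fobj Zf (fobj F A)" "Cod C n = fobj F ?T"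
      "k \<cdot> n = Ident C (fobj Zf (fobj F A))"
    using \<phi> k\<phi> by (elim is_isoE) auto
  have jn: "j \<cdot> n = \<zeta> (fobj F A)"
    using k(1-3) n c unfolding k(4)[symmetric] by simp
  show thesis
  proof (rule that[OF mj j(2-4)])
    fix w assume w: "w \<in> Arr C" "Dom C w \<in> Z" "Cod C w = fobj F A"
    obtain y where y: "y \<in> Arr C" "Dom C y = Dom C w" "Cod C y = fobj Zf (fobj F A)" "\<zeta> (fobj F A) \<cdot> y = w"
      using coreflect[of w] w by metis
    have "j \<cdot> (n \<cdot> y) = \<zeta> (fobj F A) \<cdot> y"
      by (rule Comp_eq_right1[OF jn]) (use n(1-3) y(1-3) j(1-3) in auto)
    then show "\<exists>z. z \<in> Arr C \<and> Dom C z = Dom C w \<and> Cod C z = Dom C j \<and> j \<cdot> z = w"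
      using n(1-3) y j(2) by (intro exI[of _ "n \<cdot> y"]) simp
  qed
qed

text \<open>The arrow \<open>k\<close> is the \<open>Z\<close>-kernel of \<open>q\<close>. It is computed as a pullback of the reflection of the
  torsion part of \<open>X\<close>, so that condition (S) applies.\<close>

lemma kernel_of_pullback_of_unit:
  assumes pb: "is_pullback C (\<eta> X) g p q" and B: "Dom C g = B" and X: "X \<in> Obj C"
  obtains \<chi> k i where "is_pullback C (\<zeta> B) q \<chi> k" "is_iso C i"
    "Dom C i = fobj F (Dom C \<chi>)" "Cod C i = fobj Zf B" "\<chi> = i \<cdot> \<eta> (Dom C \<chi>)"
proof -
  note d = is_pullbackD[OF pb] and T = torsion_exact[OF X]
  let ?T = "Dom C (t X)"
  have BO: "B \<in> Obj C" and TO: "?T \<in> Obj C" using d(2) T(5) B Dom_Obj by auto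
  have gX: "Cod C g = fobj F X" using d(5) X by simp
  note c = counit_zero[OF BO]
  obtain j where j: "monic C j" "Dom C j = fobj F ?T" "Cod C j = fobj F X" "j \<cdot> \<eta> ?T = \<eta> X \<cdot> t X"
    and fac: "\<And>w. w \<in> Arr C \<Longrightarrow> Dom C w \<in> Z \<Longrightarrow> Cod C w = fobj F X \<Longrightarrow>
      \<exists>z. z \<in> Arr C \<and> Dom C z = Dom C w \<and> Cod C z = Dom C j \<and> j \<cdot> z = w"
    using torsion_reflection_monic[OF X] by metis
  note ja = monic_Arr[OF j(1)]
  \<comment> \<open>\<open>g \<cdot> \<zeta> B\<close> starts at a zero object and hence factors
    through \<open>j\<close>; pulling \<open>\<eta> ?T\<close> back along the factor
    \<open>z\<close> is an instance of condition (S).\<close>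
  obtain z where z: "z \<in> Arr C" "Dom C z = fobj Zf B" "Cod C z = fobj F ?T" "j \<cdot> z = g \<cdot> \<zeta> B"
    using fac[of "g \<cdot> \<zeta> B"] c d(2) B gX j(2) by auto
  obtain \<chi> r where zr: "is_pullback C z (\<eta> ?T) \<chi> r"
    by (rule pullback_exists[of z "\<eta> ?T"]) (use z TO in auto)
  note b = is_pullbackD[OF zr]
  have bb: "Cod C \<chi> = fobj Zf B" "Cod C r = ?T" using b(7,8) z TO by auto
  have "z \<in> hom C (fobj Zf B) (fobj F ?T)" using z by (simp add: hom_def)
  then obtain i where i: "i \<in> hom C (fobj F (Dom C \<chi>)) (fobj Zf B)" "is_iso C i" "\<chi> = i \<cdot> \<eta> (Dom C \<chi>)"
    using S zr T(4) c(4) unfolding condition_S_def by blast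
  \<comment> \<open>The inclusion \<open>t X \<cdot> r\<close> and
    \<open>\<zeta> B \<cdot> \<chi>\<close> form a cone on the given pullback, which induces
    \<open>k\<close>.\<close>
  have "\<eta> X \<cdot> (t X \<cdot> r) = j \<cdot> (\<eta> ?T \<cdot> r)"
    by (rule Comp_eq_right[OF j(4)[symmetric]]) (use T(3,5) X j(2) ja TO bb b(4) in auto)
  also have "\<dots> = g \<cdot> (\<zeta> B \<cdot> \<chi>)"
    unfolding b(9)[symmetric]
    by (rule Comp_eq_right[OF z(4)]) (use z(1-3) j(2) ja bb b(3) c B d(2) in auto)
  finally have "\<eta> X \<cdot> (t X \<cdot> r) = g \<cdot> (\<zeta> B \<cdot> \<chi>)" .
  then obtain k where k: "k \<in> Arr C" "Dom C k = Dom C (t X \<cdot> r)" "Cod C k = Dom C p"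
      "p \<cdot> k = t X \<cdot> r" "q \<cdot> k = \<zeta> B \<cdot> \<chi>"
    by (rule pullback_lift[OF pb, rotated -2]) (use T(3,5) X bb b(3,4,6) c B in auto)
  have dk: "Dom C k = Dom C \<chi>" using k(2) T(5) bb b(4,6) by simp
  have "is_pullback C (\<zeta> B) q \<chi> k"
  proof (rule is_pullbackI)
    fix u v assume uv: "u \<in> Arr C" "v \<in> Arr C" "Dom C u = Dom C v" "Cod C u = Dom C (\<zeta> B)"
      "Cod C v = Dom C q" and e: "\<zeta> B \<cdot> u = q \<cdot> v"
    have "\<eta> X \<cdot> (p \<cdot> v) = g \<cdot> (q \<cdot> v)"
      by (rule Comp_eq_right[OF d(9)]) (use uv d(1-8) X in auto)
    also have "\<dots> = (g \<cdot> \<zeta> B) \<cdot> u" unfolding e[symmetric] using uv(1,4) c B d(2) by simp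
    finally have 1: "\<eta> X \<cdot> (p \<cdot> v) = (g \<cdot> \<zeta> B) \<cdot> u" .
    \<comment> \<open>For a cone \<open>(u, v)\<close>, the arrow \<open>p \<cdot> v\<close> becomes
      null under \<open>\<eta> X\<close>, because its image passes through \<open>Z B\<close>; hence
      it lifts to the torsion part.\<close>
    obtain x where x: "x \<in> Arr C" "Dom C x = Dom C (p \<cdot> v)" "Cod C x = ?T" "t X \<cdot> x = p \<cdot> v"
      by (rule torsion_lift[OF X _ _ c(4) uv(1) _ _ _ _ 1]) (use uv d(2,3,6,7) X c B in auto)
    have dx: "Dom C x = Dom C v" using x(2) uv(2,5) d(3,6) by simp
    have "j \<cdot> (z \<cdot> u) = g \<cdot> (\<zeta> B \<cdot> u)"
      by (rule Comp_eq_right[OF z(4)]) (use uv(1,4) z(1-3) ja j(2) c B d(2) in auto)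
    also have "\<dots> = \<eta> X \<cdot> (t X \<cdot> x)" using 1 x(4) uv(1,4) c B d(2) by simp
    also have "\<dots> = j \<cdot> (\<eta> ?T \<cdot> x)"
      by (rule Comp_eq_right[OF j(4)[symmetric]]) (use T(3,5) X j(2) ja TO x(1,3) in auto)
    \<comment> \<open>Cancelling the monic \<open>j\<close> makes \<open>(u, x)\<close> a cone on
      the pullback defining \<open>\<chi>\<close> and \<open>r\<close>.\<close>
    finally have "z \<cdot> u = \<eta> ?T \<cdot> x"
      by (rule monicD[OF j(1), rotated -1]) (use uv(1-4) z(1-3) j(2) TO x(1,3) dx c in auto)
    then obtain w where w: "w \<in> Arr C" "Dom C w = Dom C u" "Cod C w = Dom C \<chi>" "\<chi> \<cdot> w = u" "r \<cdot> w = x"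
      by (rule pullback_lift[OF zr, rotated -2]) (use uv(1-4) z(1-3) TO x(1,3) dx c in auto)
    have "p \<cdot> (k \<cdot> w) = t X \<cdot> (r \<cdot> w)"
      by (rule Comp_eq_right[OF k(4)]) (use k(1,3) dk w(1-3) T(5) bb b(4,6) d(3) in auto)
    then have pk: "p \<cdot> (k \<cdot> w) = p \<cdot> v" using w(5) x(4) by simp
    have "q \<cdot> (k \<cdot> w) = \<zeta> B \<cdot> (\<chi> \<cdot> w)"
      by (rule Comp_eq_right[OF k(5)]) (use k(1,3) dk w(1-3) c bb b(3) d(4,6) in auto)
    then have qk: "q \<cdot> (k \<cdot> w) = q \<cdot> v" using w(4) e by simp
    have "k \<cdot> w = v"
      by (rule pullback_cancel[OF pb _ _ _ _ _ pk qk]) (use k(1,3) dk w(1-3) uv d(6) in auto)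
    then show "\<exists>w. w \<in> Arr C \<and> Dom C w = Dom C u \<and> Cod C w = Dom C \<chi> \<and> \<chi> \<cdot> w = u \<and> k \<cdot> w = v"
      using w by blast
  next
    fix w w' assume w: "w \<in> Arr C" "w' \<in> Arr C" "Dom C w = Dom C w'" "Cod C w = Dom C \<chi>"
      "Cod C w' = Dom C \<chi>" and e: "\<chi> \<cdot> w = \<chi> \<cdot> w'" "k \<cdot> w = k \<cdot> w'"
    have *: "t X \<cdot> (r \<cdot> x) = p \<cdot> (k \<cdot> x)" if "x \<in> Arr C" "Cod C x = Dom C \<chi>" for x
      by (rule Comp_eq_right[OF k(4)[symmetric]]) (use k(1,3) dk that T(5) bb b(4,6) d(3) in auto)
    have "t X \<cdot> (r \<cdot> w) = t X \<cdot> (r \<cdot> w')" using *[OF w(1,4)] *[OF w(2,5)] e(2) by simp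
    then have "r \<cdot> w = r \<cdot> w'"
      by (rule monicD[OF torsion_monic[OF X], rotated -1]) (use w bb b(4,6) in auto)
    with e(1) show "w = w'" by (rule pullback_cancel[OF zr w])
  qed (use k dk bb b(3) c d(4,6,8) B in auto)
  then show thesis using i that by (simp add: hom_def)
qed

text \<open>The arrow \<open>m\<close> compares \<open>q\<close> with the unit at its domain. As
  \<open>q\<close> is a regular epi, \<open>m\<close> is invertible once it is known to be
  monic.\<close>

lemma pullback_of_unit_reflection:
  assumes pb: "is_pullback C (\<eta> X) g p q" and F: "Dom C g \<in> \<F>" and X: "X \<in> Obj C"
  obtains m where "is_iso C m" "Dom C m = fobj F (Dom C q)" "Cod C m = Dom C g" "m \<cdot> \<eta> (Dom C q) = q"
proof -
  note d = is_pullbackD[OF pb]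
  let ?B = "Dom C g" and ?P = "Dom C q"
  have PO: "?P \<in> Obj C" and BO: "?B \<in> Obj C" using d Dom_Obj by auto
  note c = counit_zero[OF BO]
  have qe: "regular_epi C q"
    by (rule regular_epi_pullback[OF is_pullback_sym[OF pb] unit_regular_epi[OF X]])
  obtain m where m: "m \<in> Arr C" "Dom C m = fobj F ?P" "Cod C m = ?B" "m \<cdot> \<eta> ?P = q"
    using reflect[of q] d(4,8) F by metis
  obtain \<chi> k i where k: "is_pullback C (\<zeta> ?B) q \<chi> k" and i: "is_iso C i" "Dom C i = fobj F (Dom C \<chi>)"
      "Cod C i = fobj Zf ?B" "\<chi> = i \<cdot> \<eta> (Dom C \<chi>)"
    by (rule kernel_of_pullback_of_unit[OF pb refl X])
  note dk = is_pullbackD[OF k]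
  let ?T = "Dom C \<chi>"
  have TO: "?T \<in> Obj C" using dk(3) Dom_Obj by simp
  obtain n l where nl: "is_pullback C (\<zeta> ?B) m n l"
    by (rule pullback_exists[of "\<zeta> ?B" m]) (use c m in auto)
  note dn = is_pullbackD[OF nl]
  have codk: "Cod C k = ?P" using dk(8) by simp
  have codn: "Cod C n = fobj Zf ?B" and cod\<chi>: "Cod C \<chi> = fobj Zf ?B" using dn(7) dk(7) c by auto
  have "\<zeta> ?B \<cdot> \<chi> = m \<cdot> (\<eta> ?P \<cdot> k)"
    using Comp_eq_right1[OF m(4), of k] dk(4,9) codk m(1-3) PO by simp
  then obtain a where a: "a \<in> Arr C" "Dom C a = Dom C \<chi>" "Cod C a = Dom C n" "n \<cdot> a = \<chi>" "l \<cdot> a = \<eta> ?P \<cdot> k"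
    by (rule pullback_lift[OF nl, rotated -2]) (use dk(3,4,6,7) codk m PO in auto)
  have "is_pullback C (\<zeta> ?B) (m \<cdot> \<eta> ?P) \<chi> k" unfolding m(4) by (rule k)
  \<comment> \<open>The square of \<open>\<chi>\<close> and \<open>k\<close> is the pasting of the
    one of \<open>n\<close> and \<open>l\<close> with this one, so \<open>a\<close> is a pullback of
    the unit at \<open>?P\<close>.\<close>
  then have "is_pullback C l (\<eta> ?P) a k"
    by (rule pullback_left_cancel[OF _ nl]) (use a m PO in auto)
  then have ae: "regular_epi C a" using regular_epi_pullback unit_regular_epi[OF PO] by blast
  have "monic C l" by (rule pullback_monic[OF nl c(5)])
  then have "Dom C l \<in> \<F>"
    by (rule torsion_free_subobject) (use dn(8) m PO in auto)
  then have NF: "Dom C n \<in> \<F>" using dn(6) by simp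
  \<comment> \<open>Zero objects are torsion-free, so arrows from \<open>fobj F ?T\<close> to
    \<open>Z B\<close> may be compared after the unit.\<close>
  have ZF: "fobj Zf ?B \<in> \<F>" using c(4) torsion unfolding Z_torsion_theory_def by blast
  obtain i' where i': "i \<in> Arr C" "i' \<in> Arr C" "Dom C i' = fobj Zf ?B" "Cod C i' = fobj F ?T"
      "i' \<cdot> i = Ident C (fobj F ?T)" "i \<cdot> i' = Ident C (fobj Zf ?B)"
    using i by (elim is_isoE) auto
  \<comment> \<open>\<open>Dom C n\<close> is torsion-free, so \<open>a\<close> extends along the
    unit at \<open>?T\<close>. The candidate inverse of \<open>n\<close> is this extension after the
    inverse of \<open>i\<close>.\<close>
  obtain h where h: "h \<in> Arr C" "Dom C h = fobj F ?T" "Cod C h = Dom C n" "h \<cdot> \<eta> ?T = a"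
    using reflect[of a] a(1-3) NF by metis
  have "(n \<cdot> h) \<cdot> \<eta> ?T = i \<cdot> \<eta> ?T"
    using h a(4) i(4) dn(3) TO by simp
  then have nh: "n \<cdot> h = i"
    by (rule reflect_unique[OF TO, rotated -1]) (use h(1-3) dn(3) codn ZF i'(1) i(2,3) in auto)
  have hi: "h \<cdot> i' \<in> Arr C" "Dom C (h \<cdot> i') = fobj Zf ?B" "Cod C (h \<cdot> i') = Dom C n"
    using h(1-3) i'(1-4) by auto
  have 1: "n \<cdot> (h \<cdot> i') = Ident C (fobj Zf ?B)"
    using Comp_eq_right1[OF nh, of i'] h(1-3) i'(2-4,6) dn(3) by simp
  have "i' \<cdot> (n \<cdot> a) = \<eta> ?T"
    using Comp_eq_right1[OF i'(5), of "\<eta> ?T"] a(4) i(2-4) i'(1-4) TO by simp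
  then have "h \<cdot> (i' \<cdot> (n \<cdot> a)) = a" using h(4) by simp
  then have "((h \<cdot> i') \<cdot> n) \<cdot> a = Ident C (Dom C n) \<cdot> a"
    using h(1-3) i'(2-4) dn(3) codn a(1-3) by simp
  \<comment> \<open>The second inverse law holds after precomposition with \<open>a\<close>, which
    is a regular epi.\<close>
  then have 2: "(h \<cdot> i') \<cdot> n = Ident C (Dom C n)"
    by (rule regular_epi_cancel[OF ae, rotated -1]) (use hi dn(3) codn a(3) Dom_Obj in auto)
  have "is_iso C n"
    by (rule is_isoI[OF dn(3) hi(1)]) (use hi 1 2 codn in auto)
  then have mm: "monic C m" using pullback_reflects_monic[OF nl] iso_monic by blast
  have "regular_epi C (m \<cdot> \<eta> ?P)" unfolding m(4) by (rule qe)
  then have "is_iso C m"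
    by (rule regular_epi_strong[OF _ mm]) (use m PO in auto)
  then show thesis using m(2-4) that by blast
qed

lemma reflection_admissible:
  "admissible_galois_structure C (full_sub C \<F>) F inclusion \<eta> \<epsilon> (Arr C) (Arr (full_sub C \<F>))"
proof -
  have pbs: "has_pullbacks C"
    using regular by (simp add: regular_category_def finitely_complete_def)
  have ex: "\<exists>h. h \<in> Arr C \<and> Dom C h = Dom C g \<and> Cod C h = Cod C v \<and> h \<cdot> q = v"
    if X: "X \<in> Obj C" and pb: "is_pullback C (\<eta> X) g p q" and F: "Dom C g \<in> \<F>"
      and v: "v \<in> Arr C" "Dom C v = Dom C q" "Cod C v \<in> \<F>" for X g p q v
  proof -
    obtain m where m: "is_iso C m" "Dom C m = fobj F (Dom C q)" "Cod C m = Dom C g" "m \<cdot> \<eta> (Dom C q) = q"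
      by (rule pullback_of_unit_reflection[OF pb F X])
    obtain n where n: "m \<in> Arr C" "n \<in> Arr C" "Dom C n = Dom C g" "Cod C n = fobj F (Dom C q)"
        "n \<cdot> m = Ident C (fobj F (Dom C q))"
      using m by (elim is_isoE) auto
    have P: "Dom C q \<in> Obj C" using is_pullbackD(4)[OF pb] Dom_Obj by simp
    obtain h where h: "h \<in> Arr C" "Dom C h = fobj F (Dom C q)" "Cod C h = Cod C v" "h \<cdot> \<eta> (Dom C q) = v"
      using reflect[of v] v by metis
    \<comment> \<open>Through the inverse \<open>n\<close> of \<open>m\<close>, extending along
      \<open>q\<close> amounts to extending along the unit at \<open>Dom C q\<close>.\<close>
    have nq: "n \<cdot> q = \<eta> (Dom C q)"
      using Comp_eq_right1[OF n(5), of "\<eta> (Dom C q)"] m(2-4) n(1-4) P by simp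
    have "(h \<cdot> n) \<cdot> q = h \<cdot> (n \<cdot> q)"
      using h(1-3) n(1-4) is_pullbackD(4,8)[OF pb] by simp
    then have "(h \<cdot> n) \<cdot> q = v" unfolding nq h(4) .
    then show ?thesis using h(1-3) n(1-4) by (intro exI[of _ "h \<cdot> n"]) simp
  qed
  \<comment> \<open>Uniqueness of extensions holds because \<open>q\<close>, a pullback of a unit
    component, is a regular epi.\<close>
  have un: "h = h'"
    if X: "X \<in> Obj C" and pb: "is_pullback C (\<eta> X) g p q" and "Dom C g \<in> \<F>"
      and h: "h \<in> Arr C" "h' \<in> Arr C" "Dom C h = Dom C g" "Dom C h' = Dom C g" "Cod C h = Cod C h'"
      and e: "h \<cdot> q = h' \<cdot> q" for X g p q h h'
  proof (rule regular_epi_cancel[OF _ h(1,2,5) _ _ e])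
    show "regular_epi C q"
      by (rule regular_epi_pullback[OF is_pullback_sym[OF pb] unit_regular_epi[OF X]])
  qed (use h is_pullbackD(8)[OF pb] in auto)
  show ?thesis
    unfolding admissible_galois_structure_def
  proof (intro conjI ballI)
    fix X assume X: "X \<in> Obj C"
    show "full_functor (slice_on (full_sub C \<F>) (Arr (full_sub C \<F>)) (fobj F X)) (slice_on C (Arr C) X)
        (slice_right_adjoint C inclusion \<eta> X)"
      by (rule slice_right_adjoint_full_faithful(1)[OF pbs X ex[OF X] un[OF X]])
    show "faithful_functor (slice_on (full_sub C \<F>) (Arr (full_sub C \<F>)) (fobj F X)) (slice_on C (Arr C) X)
        (slice_right_adjoint C inclusion \<eta> X)"
      by (rule slice_right_adjoint_full_faithful(2)[OF pbs X ex[OF X] un[OF X]])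
  qed (rule relatively_admissible[OF pbs])
qed

end

theorem corollary4p16:
  fixes C :: "('o, 'a) cat"
    and Z \<T> \<F> :: "'o set"
    and Zf F :: "('o, 'a, 'o, 'a) cfunctor"
    and \<zeta> t \<eta> \<epsilon> :: "'o \<Rightarrow> 'a"
  assumes "regular_category C"
    and "protomodular C"
    and "class_of_zero_objects C Z Zf \<zeta>"
    and "Z_torsion_theory C Z \<T> \<F> t \<eta>"
    and "adjunction C (full_sub C \<F>) F inclusion \<eta> \<epsilon>"
    and "condition_M' C Zf t F"
    and "condition_S C Z \<T> F \<eta>"
  shows "admissible_galois_structure C (full_sub C \<F>) F inclusion \<eta> \<epsilon> (Arr C) (Arr (full_sub C \<F>))"
proof -
  have "category C" using assms(2) by (simp add: protomodular_def)
  moreover have "replete C \<F>" using assms(4) by (simp add: Z_torsion_theory_def)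
  ultimately interpret torsion_theory C \<F> F \<eta> \<epsilon> Z Zf \<zeta> \<T> t
    using assms
    by (intro torsion_theory.intro regular_protomodular.intro regular_cat.intro plain_category.intro
        reflective.intro zero_objects.intro regular_cat_axioms.intro regular_protomodular_axioms.intro
        reflective_axioms.intro zero_objects_axioms.intro torsion_theory_axioms.intro)
  show ?thesis by (rule reflection_admissible)
qed

end
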